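(* Let $\Omega\subsetneq\mathbb{C}$ be a hyperbolic domain, $\pi:\mathbb{D}\to\Omega$ a universal covering map with deck transformation group $\Gamma$, and $g:\Omega\to\Omega$ a holomorphic self-map without fixed points in $\Omega$. Let $\widetilde g:\mathbb{D}\to\mathbb{D}$ be a holomorphic lift satisfying $\pi\circ\widetilde g=g\circ\pi$. Assume that $\widetilde g$ is hyperbolic, with Denjoy--Wolff point $\tau\in\partial\mathbb{D}$ and angular multiplier $\alpha\in(0,1)$, and that $\tau\notin\Lambda(\Gamma)$. Suppose that, for some $z\in\mathbb{D}$, $\widetilde g^{\circ n}(z)\to\tau$ non-tangentially as $n\to\infty$. Then $g$ has an extremal hyperbolic rate in $\Omega$ if and only if $\widetilde g$ has an extremal hyperbolic rate in $\mathbb{D}$. Equivalently, $g$ has an extremal hyperbolic rate if and only if the Herglotz measure $\sigma$ associated with $\widetilde g$ satisfies $$\int_{\partial\mathbb{D}\setminus\{\tau\}}\log\frac{1}{|\zeta-\tau|}\,d\sigma(\zeta)<+\infty.$$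
   Context: $\mathbb{D}=\{z\in\mathbb{C}:|z|<1\}$. $g^{\circ n}$ denotes the $n$-th iterate. For a hyperbolic domain $\Omega$, $\rho_\Omega$ is the distance induced by the Poincaré metric of curvature $-1$; for the disk, $\rho_{\mathbb{D}}(z,w)=2\tanh^{-1}\left|\frac{z-w}{1-\bar w z}\right|$. $O(1)$ denotes a quantity bounded independently of $n$. The deck transformation group of $\pi$ is $\Gamma=\{\gamma\in\operatorname{Aut}(\mathbb{D}):\pi\circ\gamma=\pi\}$; its limit set is $\Lambda(\Gamma)=\overline{\Gamma(z)}\cap\partial\mathbb{D}$, with closure of the orbit taken in $\overline{\mathbb{D}}$ (independent of $z\in\mathbb{D}$). A sequence $z_n\in\mathbb{D}$ converges non-tangentially to $\tau\in\partial\mathbb{D}$ if $z_n\to\tau$ and for some $M>1$ one has $|z_n-\tau|<M(1-|z_n|)$ for all large $n$. A holomorphic $G:\mathbb{D}\to\mathbb{D}$ with no fixed point in $\mathbb{D}$ has a unique Denjoy--Wolff point $\tau\in\partial\mathbb{D}$, with $G^{\circ n}(z)\to\tau$ for every $z\in\mathbb{D}$; the non-tangential limit $\alpha:=\angle\lim_{z\to\tau}G'(z)$ exists, equals $\liminf_{z\to\tau}\frac{1-|G(z)|}{1-|z|}$, and lies in $(0,1]$ (the angular multiplier). $G$ is hyperbolic if $\alpha\in(0,1)$. A hyperbolic $G$ has an extremal hyperbolic rate in $\mathbb{D}$ if for some (equivalently, every) $z,w\in\mathbb{D}$, $\rho_{\mathbb{D}}(G^{\circ n}(z),w)=n\log\frac1\alpha+O(1)$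 as $n\to\infty$. Likewise, $g$ has an extremal hyperbolic rate in $\Omega$ if for some (equivalently, every) $z,w\in\Omega$, $\rho_\Omega(g^{\circ n}(z),w)=n\log\frac1\alpha+O(1)$, where $\alpha$ is the multiplier of the lift $\widetilde g$. The Herglotz measure associated with a hyperbolic $G$ is the finite positive Borel measure $\sigma$ on $\partial\mathbb{D}\setminus\{\tau\}$ for which there is $b\in\mathbb{R}$ with $$\frac{1+\overline{\tau}G(z)}{1-\overline{\tau}G(z)}=\frac{1}{\alpha}\,\frac{1+\overline{\tau}z}{1-\overline{\tau}z}+ib+\int_{\partial\mathbb{D}\setminus\{\tau\}}\frac{\zeta+z}{\zeta-z}\,d\sigma(\zeta),\qquad z\in\mathbb{D}.$$ *)

theory Defs
  imports
    "HOL-Complex_Analysis.Complex_Analysis"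
    "HOL-Library.Landau_Symbols"
begin

abbreviation unit_disc :: "complex set" (\<open>\<D>\<close>)
  where "\<D> \<equiv> ball 0 1"

definition hyperbolic_domain :: "complex set \<Rightarrow> bool"
  where "hyperbolic_domain \<Omega> \<longleftrightarrow>
    open \<Omega> \<and> connected \<Omega> \<and> \<Omega> \<noteq> {} \<and> (\<exists>a b. a \<noteq> b \<and> a \<notin> \<Omega> \<and> b \<notin> \<Omega>)"

text \<open>Universality is automatic, since the disc is simply connected.\<close>

definition universal_covering_map :: "(complex \<Rightarrow> complex) \<Rightarrow> complex set \<Rightarrow> bool"
  where "universal_covering_map p \<Omega> \<longleftrightarrow> p holomorphic_on \<D> \<and> covering_space \<D> p \<Omega>"

text \<open>
  The density of the metric of curvature \<open>-1\<close> on \<open>\<Omega>\<close> is the push-forward of the density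
  \<open>2 / (1 - |z|^2)\<close> of the disc. The value does not depend on the choice of \<open>p\<close> and \<open>z\<close>:
  two universal covering maps differ by an automorphism of the disc.
\<close>

definition poincare_density :: "complex set \<Rightarrow> complex \<Rightarrow> real"
  where "poincare_density \<Omega> w =
    (THE l. \<exists>p z. universal_covering_map p \<Omega> \<and> z \<in> \<D> \<and> p z = w \<and>
                  l = 2 / ((1 - (cmod z)\<^sup>2) * cmod (deriv p z)))"

text \<open>
  The length is required to exist via \<open>has_integral\<close>: a \<^const>\<open>valid_path\<close> need not be
  rectifiable, and \<^const>\<open>integral\<close> would assign the value \<open>0\<close> to a non-integrable speed.
\<close>

definition poincare_dist :: "complex set \<Rightarrow> complex \<Rightarrow> complex \<Rightarrow> real"
  where "poincare_dist \<Omega> z w =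
    Inf {L. \<exists>c. valid_path c \<and> path_image c \<subseteq> \<Omega> \<and> pathstart c = z \<and> pathfinish c = w \<and>
      ((\<lambda>t. poincare_density \<Omega> (c t) * cmod (vector_derivative c (at t within {0..1})))
         has_integral L) {0..1}}"

text \<open>
  The inverse of a holomorphic bijection is automatically holomorphic. Values outside the disc are
  unconstrained, so elements represent an automorphism only through their restriction to \<open>\<D>\<close>.
\<close>

definition disc_automorphisms :: "(complex \<Rightarrow> complex) set"
  where "disc_automorphisms = {\<gamma>. \<gamma> holomorphic_on \<D> \<and> bij_betw \<gamma> \<D> \<D>}"

definition deck_group :: "(complex \<Rightarrow> complex) \<Rightarrow> (complex \<Rightarrow> complex) set"
  where "deck_group p = {\<gamma> \<in> disc_automorphisms. \<forall>z\<in>\<D>. p (\<gamma> z) = p z}"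

text \<open>The accumulation set on the circle is the same for every orbit; we use the orbit of \<open>0\<close>.\<close>

definition limit_set :: "(complex \<Rightarrow> complex) set \<Rightarrow> complex set"
  where "limit_set \<Gamma> = closure {\<gamma> 0 |\<gamma>. \<gamma> \<in> \<Gamma>} \<inter> sphere 0 1"

definition stolz_region :: "complex \<Rightarrow> real \<Rightarrow> complex set"
  where "stolz_region \<tau> M = {z \<in> \<D>. cmod (z - \<tau>) < M * (1 - cmod z)}"

definition nontangential_seq :: "(nat \<Rightarrow> complex) \<Rightarrow> complex \<Rightarrow> bool"
  where "nontangential_seq s \<tau> \<longleftrightarrow>
    s \<longlonglongrightarrow> \<tau> \<and> (\<exists>M>1. \<forall>\<^sub>F n in sequentially. s n \<in> stolz_region \<tau> M)"

definition angular_limit :: "(complex \<Rightarrow> complex) \<Rightarrow> complex \<Rightarrow> complex \<Rightarrow> bool"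
  where "angular_limit f \<tau> l \<longleftrightarrow> (\<forall>M>1. (f \<longlongrightarrow> l) (at \<tau> within stolz_region \<tau> M))"

definition denjoy_wolff_point :: "(complex \<Rightarrow> complex) \<Rightarrow> complex \<Rightarrow> bool"
  where "denjoy_wolff_point G \<tau> \<longleftrightarrow>
    \<tau> \<in> sphere 0 1 \<and> (\<forall>z\<in>\<D>. (\<lambda>n. (G ^^ n) z) \<longlonglongrightarrow> \<tau>)"

definition angular_multiplier :: "(complex \<Rightarrow> complex) \<Rightarrow> complex \<Rightarrow> real \<Rightarrow> bool"
  where "angular_multiplier G \<tau> \<alpha> \<longleftrightarrow> angular_limit (deriv G) \<tau> (of_real \<alpha>)"

definition hyperbolic_self_map :: "(complex \<Rightarrow> complex) \<Rightarrow> complex \<Rightarrow> real \<Rightarrow> bool"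
  where "hyperbolic_self_map G \<tau> \<alpha> \<longleftrightarrow>
    G holomorphic_on \<D> \<and> G ` \<D> \<subseteq> \<D> \<and> (\<forall>z\<in>\<D>. G z \<noteq> z) \<and>
    denjoy_wolff_point G \<tau> \<and> angular_multiplier G \<tau> \<alpha> \<and> 0 < \<alpha> \<and> \<alpha> < 1"

text \<open>For a map of \<open>\<Omega>\<close>, the parameter \<open>\<alpha>\<close> is the angular multiplier of its lift to the disc.\<close>

definition extremal_hyperbolic_rate :: "complex set \<Rightarrow> (complex \<Rightarrow> complex) \<Rightarrow> real \<Rightarrow> bool"
  where "extremal_hyperbolic_rate \<Omega> f \<alpha> \<longleftrightarrow>
    (\<exists>z\<in>\<Omega>. \<exists>w\<in>\<Omega>.
      (\<lambda>n. poincare_dist \<Omega> ((f ^^ n) z) w - real n * ln (1 / \<alpha>)) \<in> O(\<lambda>_. 1))"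

definition herglotz_measure ::
    "(complex \<Rightarrow> complex) \<Rightarrow> complex \<Rightarrow> real \<Rightarrow> complex measure \<Rightarrow> bool"
  where "herglotz_measure G \<tau> \<alpha> \<sigma> \<longleftrightarrow>
    sets \<sigma> = sets (restrict_space borel (sphere 0 1 - {\<tau>})) \<and> finite_measure \<sigma> \<and>
    (\<exists>b::real. \<forall>z\<in>\<D>.
      (1 + cnj \<tau> * G z) / (1 - cnj \<tau> * G z) =
        of_real (1 / \<alpha>) * ((1 + cnj \<tau> * z) / (1 - cnj \<tau> * z)) + \<i> * of_real b +
        (LINT \<zeta>|\<sigma>. (\<zeta> + z) / (\<zeta> - z)))"

text \<open>
  On the circle \<open>log (1 / |\<zeta> - \<tau>|) \<ge> - log 2\<close> and \<open>\<sigma>\<close> is finite, so the integral always exists in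
  \<open>(-\<infinity>, \<infinity>]\<close>, and it is \<open>< \<infinity>\<close> exactly when the function is integrable.
\<close>

definition finite_log_integral :: "complex measure \<Rightarrow> complex \<Rightarrow> bool"
  where "finite_log_integral \<sigma> \<tau> \<longleftrightarrow> integrable \<sigma> (\<lambda>\<zeta>. ln (1 / cmod (\<zeta> - \<tau>)))"

end

theory Submission
  imports Defs
begin

text \<open>
  Let \<open>d\<close> be the hyperbolic distance of the disc (\<open>disc_dist\<close>) and let \<open>z\<^sub>n\<close> be an orbit of
  \<open>G\<close> that tends to \<open>\<tau>\<close> inside a Stolz region. By Schwarz-Pick the choice of base points changes the
  distances in question by bounded amounts, so both extremal rates are statements about this orbit.

  The rate in \<open>\<Omega>\<close> and the rate in the disc. Since \<open>p\<close> preserves lengths and curves lift, the distance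
  from \<open>p z\<close> to \<open>p 0\<close> in \<open>\<Omega>\<close> is the distance from \<open>z\<close> to the deck orbit of \<open>0\<close>
  (\<open>poincare_dist_covering_le\<close>, \<open>poincare_dist_covering_ge\<close>, \<open>deck_transformation_exists\<close>). As \<open>\<tau>\<close> is
  not a limit point, this orbit stays away from \<open>\<tau>\<close>. For points \<open>a\<close> away from \<open>\<tau>\<close> and \<open>z\<close> near \<open>\<tau>\<close>,
  \<open>1 - cnj a * z\<close> is bounded below, and then \<open>d z a \<ge> d z 0 - O(1)\<close>
  (\<open>disc_dist_away_from_boundary_point\<close>). So the distances of \<open>p z\<^sub>n\<close> to \<open>p 0\<close> in \<open>\<Omega>\<close> and of
  \<open>z\<^sub>n\<close> to \<open>0\<close> in the disc differ by \<open>O(1)\<close>, and the two rates are extremal together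
  (\<open>extremal_rate_covering_iff\<close>).

  The rate in the disc and the Herglotz measure. Put \<open>x\<^sub>n = (1 - |z\<^sub>n|^2) / |z\<^sub>n - \<tau>|^2\<close>,
  the real part of the half-plane coordinate of \<open>z\<^sub>n\<close>. Because the orbit is non-tangential,
  \<open>d z\<^sub>n 0 = ln x\<^sub>n + O(1)\<close>. The real part of the Herglotz formula at \<open>z\<^sub>n\<close> reads
  \<open>x\<^sub>n\<^sub>+\<^sub>1 = (x\<^sub>n / \<alpha>) * (1 + \<alpha> * a\<^sub>n)\<close>, where \<open>a\<^sub>n\<close> is the integral of
  \<open>(|z\<^sub>n - \<tau>| / |\<zeta> - z\<^sub>n|)^2\<close> over \<open>\<sigma>\<close> (\<open>herglotz_recursion\<close>). Hence \<open>x\<^sub>n * \<alpha>^n\<close> is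
  nondecreasing, and it is bounded, which is the extremal rate, if and only if the sum of the \<open>a\<^sub>n\<close>
  is finite (\<open>growth_bounded_iff_summable\<close>).

  It remains to sum under the integral. Non-tangentially, \<open>|\<zeta> - z\<^sub>n|\<close> is comparable to
  \<open>|\<zeta> - \<tau>| + |z\<^sub>n - \<tau>|\<close>, and \<open>|z\<^sub>n - \<tau>|\<close> is comparable to \<open>1 / x\<^sub>n\<close>, which
  is at most a multiple of \<open>\<alpha>^n\<close>; if \<open>x\<^sub>n * \<alpha>^n\<close> is bounded, it is also at least a positive
  multiple of \<open>\<alpha>^n\<close>. So the \<open>n\<close>-th integrand is of order \<open>1\<close> while \<open>\<alpha>^n > |\<zeta> - \<tau>|\<close> and
  decays geometrically afterwards; the sum
  over \<open>n\<close> is comparable to \<open>ln (1 / |\<zeta> - \<tau>|)\<close> near \<open>\<tau>\<close> (\<open>log_integral_imp_summable\<close>,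
  \<open>summable_imp_log_integral\<close>).
\<close>

section \<open>The hyperbolic distance of the disc\<close>

text \<open>
  The distance of the metric with density \<open>2 / (1 - |z|^2)\<close>, as \<open>poincare_dist_disc\<close> shows.
\<close>

definition disc_dist :: "complex \<Rightarrow> complex \<Rightarrow> real"
  where "disc_dist z w = 2 * artanh (cmod (Moebius_function 0 w z))"

lemma Moebius_denominator_nonzero:
  assumes "cmod w < 1" "cmod z \<le> 1"
  shows "1 - cnj w * z \<noteq> 0"
proof
  assume "1 - cnj w * z = 0"
  then have "cmod (cnj w * z) = 1" by (metis eq_iff_diff_eq_0 norm_one)
  moreover have "cmod (cnj w * z) < 1"
    using assms by (simp add: norm_mult) (metis mult_left_le norm_ge_zero order_le_less_trans)
  ultimately show False by simp
qed

lemma one_minus_norm_Moebius_squared: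
  assumes "cmod w < 1" "cmod z < 1"
  shows "1 - (cmod (Moebius_function 0 w z))\<^sup>2 =
    (1 - (cmod z)\<^sup>2) * (1 - (cmod w)\<^sup>2) / (cmod (1 - cnj w * z))\<^sup>2"
proof -
  have nz: "cmod (1 - cnj w * z) \<noteq> 0" using Moebius_denominator_nonzero assms by simp
  have "(cmod (1 - cnj w * z))\<^sup>2 - (cmod (z - w))\<^sup>2 = (1 - (cmod z)\<^sup>2) * (1 - (cmod w)\<^sup>2)"
    unfolding cmod_power2 by (simp add: power2_eq_square algebra_simps)
  then show ?thesis using nz
    by (simp add: Moebius_function_simple norm_divide power_divide field_simps)
qed

lemma DERIV_Moebius_function:
  assumes "cmod w < 1" "cmod z \<le> 1"
  shows "(Moebius_function 0 w has_field_derivative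
           of_real (1 - (cmod w)\<^sup>2) / (1 - cnj w * z)\<^sup>2) (at z)"
proof -
  have "((\<lambda>z. (z - w) / (1 - cnj w * z)) has_field_derivative
           (1 - w * cnj w) / (1 - cnj w * z)\<^sup>2) (at z)"
    using Moebius_denominator_nonzero[OF assms]
    by (auto intro!: derivative_eq_intros simp: power2_eq_square algebra_simps)
  then show ?thesis
    using complex_norm_square[of w] by (simp add: Moebius_function_simple[abs_def])
qed

lemma Moebius_self_map:
  assumes "w \<in> \<D>"
  shows "Moebius_function 0 w ` \<D> \<subseteq> \<D>"
  using assms Moebius_function_norm_lt_1 by auto

lemma one_minus_norm_sq_pos: "z \<in> \<D> \<Longrightarrow> 0 < 1 - (cmod z)\<^sup>2"
  by (simp add: power_less_one_iff)

text \<open>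
  Conjugating \<open>f\<close> by the automorphisms of the disc that move \<open>w\<close> and \<open>f w\<close> to the origin
  reduces both inequalities to the Schwarz lemma.
\<close>

lemma Schwarz_Pick:
  assumes f: "f holomorphic_on \<D>" "f ` \<D> \<subseteq> \<D>" and w: "w \<in> \<D>"
  shows Schwarz_Pick_deriv: "cmod (deriv f w) * (1 - (cmod w)\<^sup>2) \<le> 1 - (cmod (f w))\<^sup>2"
    and Schwarz_Pick_norm: "z \<in> \<D> \<Longrightarrow>
      cmod (Moebius_function 0 (f w) (f z)) \<le> cmod (Moebius_function 0 w z)"
proof -
  have w1: "cmod w < 1" "cmod (- w) < 1" and fw: "f w \<in> \<D>" and fw1: "cmod (f w) < 1"
    using w f by (auto simp: image_subset_iff)
  define F where "F = Moebius_function 0 (f w) \<circ> f \<circ> Moebius_function 0 (- w)"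
  have M0: "Moebius_function 0 (- w) 0 = w" by (simp add: Moebius_function_simple)
  have Mw: "Moebius_function 0 (- w) ` \<D> \<subseteq> \<D>" using w by (intro Moebius_self_map) auto
  have hol: "F holomorphic_on \<D>"
    unfolding F_def
  proof (intro holomorphic_on_compose)
    show "Moebius_function 0 (- w) holomorphic_on \<D>" by (rule Moebius_function_holomorphic) fact
    show "f holomorphic_on Moebius_function 0 (- w) ` \<D>" using f(1) Mw holomorphic_on_subset by blast
    show "Moebius_function 0 (f w) holomorphic_on f ` Moebius_function 0 (- w) ` \<D>"
      by (rule holomorphic_on_subset[OF Moebius_function_holomorphic[OF fw1]]) (use Mw f in fastforce)
  qed
  have F0: "F 0 = 0" by (simp add: F_def M0 Moebius_function_eq_zero)
  have FD: "cmod (F z) < 1" if "cmod z < 1" for z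
  proof -
    have "F z \<in> \<D>" using that Mw f(2) Moebius_self_map[OF fw] by (fastforce simp: F_def image_subset_iff)
    then show ?thesis by simp
  qed
  have Sch: "cmod (F \<xi>) \<le> cmod \<xi>" "cmod (deriv F 0) \<le> 1" if "cmod \<xi> < 1" for \<xi>
    using Schwarz_Lemma[OF hol F0 FD that] by auto
  { assume z: "z \<in> \<D>"
    have zz: "Moebius_function 0 (- w) (Moebius_function 0 w z) = z"
      using w z by (intro Moebius_function_compose) auto
    have "cmod (Moebius_function 0 w z) < 1" using w z by (intro Moebius_function_norm_lt_1) auto
    from Sch(1)[OF this] show "cmod (Moebius_function 0 (f w) (f z)) \<le> cmod (Moebius_function 0 w z)"
      by (simp add: F_def zz) }
  have d1: "(Moebius_function 0 (- w) has_field_derivative of_real (1 - (cmod w)\<^sup>2)) (at 0)"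
    using DERIV_Moebius_function[of "-w" 0] w1 by simp
  have d2: "(f has_field_derivative deriv f w) (at (Moebius_function 0 (- w) 0))"
    unfolding M0 using f(1) w by (intro holomorphic_derivI[of f "\<D>"]) auto
  have e: "1 - cnj (f w) * f w = of_real (1 - (cmod (f w))\<^sup>2)"
    using complex_norm_square[of "f w"] by (simp add: mult.commute)
  have p: "0 < 1 - (cmod (f w))\<^sup>2" using fw by (rule one_minus_norm_sq_pos)
  have d3: "(Moebius_function 0 (f w) has_field_derivative 1 / of_real (1 - (cmod (f w))\<^sup>2))
     (at (f (Moebius_function 0 (- w) 0)))"
  proof -
    have q: "of_real r / (of_real r)\<^sup>2 = 1 / complex_of_real r" for r :: real
      by (cases "r = 0") (simp_all add: power2_eq_square)
    show ?thesis
      using DERIV_Moebius_function[OF fw1 less_imp_le[OF fw1]] unfolding e M0 q .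
  qed
  have "(F has_field_derivative 1 / of_real (1 - (cmod (f w))\<^sup>2) *
           (deriv f w * of_real (1 - (cmod w)\<^sup>2))) (at 0)"
    unfolding F_def using DERIV_chain[OF DERIV_chain[OF d3 d2] d1] by (simp only: mult.assoc)
  then have "deriv F 0 = 1 / of_real (1 - (cmod (f w))\<^sup>2) * (deriv f w * of_real (1 - (cmod w)\<^sup>2))"
    by (rule DERIV_imp_deriv)
  moreover have "cmod (deriv F 0) \<le> 1" using Sch(2)[of 0] by simp
  ultimately have "cmod (deriv f w) * \<bar>1 - (cmod w)\<^sup>2\<bar> / \<bar>1 - (cmod (f w))\<^sup>2\<bar> \<le> 1"
    by (simp add: norm_mult norm_divide del: of_real_diff)
  then show "cmod (deriv f w) * (1 - (cmod w)\<^sup>2) \<le> 1 - (cmod (f w))\<^sup>2"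
    using p one_minus_norm_sq_pos[OF w] by (simp add: field_simps)
qed

lemma artanh_mono: "0 \<le> x \<Longrightarrow> x \<le> y \<Longrightarrow> y < 1 \<Longrightarrow> artanh x \<le> artanh (y::real)"
  unfolding artanh_def by (intro divide_right_mono ln_mono frac_le divide_pos_pos) auto

lemma disc_dist_Schwarz_Pick:
  assumes "f holomorphic_on \<D>" "f ` \<D> \<subseteq> \<D>" "z \<in> \<D>" "w \<in> \<D>"
  shows "disc_dist (f z) (f w) \<le> disc_dist z w"
  unfolding disc_dist_def using assms
  by (intro mult_left_mono artanh_mono Schwarz_Pick_norm Moebius_function_norm_lt_1) auto

lemma norm_Moebius_commute: "cmod (Moebius_function 0 w z) = cmod (Moebius_function 0 z w)"
proof -
  have "cmod (1 - cnj w * z) = cmod (1 - cnj z * w)"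
    by (metis complex_cnj_cnj complex_cnj_diff complex_cnj_mult complex_cnj_one complex_mod_cnj mult.commute)
  then show ?thesis by (simp add: Moebius_function_simple norm_divide norm_minus_commute)
qed

lemma disc_dist_commute: "disc_dist z w = disc_dist w z"
  by (simp add: disc_dist_def norm_Moebius_commute)

lemma disc_dist_0: "disc_dist z 0 = 2 * artanh (cmod z)"
  by (simp add: disc_dist_def Moebius_function_simple)

lemma disc_dist_nonneg: assumes "z \<in> \<D>" "w \<in> \<D>" shows "0 \<le> disc_dist z w"
  using artanh_mono[of 0 "cmod (Moebius_function 0 w z)"] Moebius_function_norm_lt_1 assms
  by (simp add: disc_dist_def)

text \<open>
  With the middle point at the origin the claim is the addition formula for \<open>tanh\<close>: among all \<open>a\<close>,
  \<open>b\<close> of given moduli the pseudo-hyperbolic distance is largest when they lie on opposite radii,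
  where it equals \<open>t = (|a| + |b|) / (1 + |a| |b|)\<close>, and \<open>artanh t = artanh |a| + artanh |b|\<close>.
\<close>

lemma disc_dist_triangle_0:
  assumes "a \<in> \<D>" "b \<in> \<D>"
  shows "disc_dist a b \<le> disc_dist a 0 + disc_dist 0 b"
proof -
  define s where "s = cmod (Moebius_function 0 b a)"
  define t where "t = (cmod a + cmod b) / (1 + cmod a * cmod b)"
  have ab: "cmod a < 1" "cmod b < 1" "0 \<le> cmod a" "0 \<le> cmod b" using assms by auto
  have pos: "0 < 1 + cmod a * cmod b" by (simp add: add_pos_nonneg)
  have "(1 - cmod a) * (1 - cmod b) > 0" using ab by simp
  then have t: "0 \<le> t" "t < 1" using ab pos by (auto simp: t_def field_simps)
  have "cmod (1 - cnj b * a) \<le> 1 + cmod a * cmod b"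
    by (rule order_trans[OF norm_triangle_ineq4]) (simp add: norm_mult mult.commute)
  then have le: "(cmod (1 - cnj b * a))\<^sup>2 \<le> (1 + cmod a * cmod b)\<^sup>2" by (rule power_mono) simp
  have nz: "cmod (1 - cnj b * a) > 0" using Moebius_denominator_nonzero[of b a] ab by simp
  have "1 - t\<^sup>2 = ((1 + cmod a * cmod b)\<^sup>2 - (cmod a + cmod b)\<^sup>2) / (1 + cmod a * cmod b)\<^sup>2"
    using pos by (simp add: t_def power_divide diff_divide_distrib)
  also have "(1 + cmod a * cmod b)\<^sup>2 - (cmod a + cmod b)\<^sup>2 = (1 - (cmod a)\<^sup>2) * (1 - (cmod b)\<^sup>2)"
    by (simp add: power2_eq_square algebra_simps)
  also have "\<dots> / (1 + cmod a * cmod b)\<^sup>2 \<le> \<dots> / (cmod (1 - cnj b * a))\<^sup>2"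
    using le nz pos one_minus_norm_sq_pos[OF assms(1)] one_minus_norm_sq_pos[OF assms(2)]
    by (intro divide_left_mono mult_nonneg_nonneg mult_pos_pos zero_less_power) simp_all
  also have "\<dots> = 1 - s\<^sup>2" using one_minus_norm_Moebius_squared ab by (simp add: s_def)
  finally have "s\<^sup>2 \<le> t\<^sup>2" by simp
  then have "s \<le> t" by (rule power2_le_imp_le) fact
  then have "artanh s \<le> artanh t" using t by (intro artanh_mono) (auto simp: s_def)
  also have "(1 + t) / (1 - t) = ((1 + cmod a) / (1 - cmod a)) * ((1 + cmod b) / (1 - cmod b))"
  proof -
    have "1 + t = (1 + cmod a) * (1 + cmod b) / (1 + cmod a * cmod b)"
         "1 - t = (1 - cmod a) * (1 - cmod b) / (1 + cmod a * cmod b)"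
      using pos by (auto simp: t_def field_simps)
    then show ?thesis using pos by simp
  qed
  then have "artanh t = ln (((1 + cmod a) / (1 - cmod a)) * ((1 + cmod b) / (1 - cmod b))) / 2"
    by (simp only: artanh_def)
  also have "\<dots> = artanh (cmod a) + artanh (cmod b)"
  proof -
    have "(1 + cmod a) / (1 - cmod a) > 0" "(1 + cmod b) / (1 - cmod b) > 0"
      using ab by (auto intro!: divide_pos_pos add_pos_nonneg)
    then show ?thesis unfolding artanh_def by (subst ln_mult) (auto simp: add_divide_distrib)
  qed
  finally show ?thesis
    unfolding s_def using disc_dist_0 by (simp add: disc_dist_def[of a b] disc_dist_commute[of 0 b])
qed

text \<open>
  Automorphisms do not increase the distance, and neither do their inverses.
\<close>

lemma disc_dist_Moebius:
  assumes "a \<in> \<D>" "z \<in> \<D>" "w \<in> \<D>"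
  shows "disc_dist (Moebius_function 0 a z) (Moebius_function 0 a w) = disc_dist z w"
proof (rule antisym)
  have M: "Moebius_function 0 a holomorphic_on \<D>" "Moebius_function 0 (- a) holomorphic_on \<D>"
    "Moebius_function 0 a ` \<D> \<subseteq> \<D>" "Moebius_function 0 (- a) ` \<D> \<subseteq> \<D>"
    using assms by (auto intro!: Moebius_function_holomorphic Moebius_function_norm_lt_1)
  have inv: "Moebius_function 0 (- a) (Moebius_function 0 a z) = z" if "z \<in> \<D>" for z
    using assms that by (intro Moebius_function_compose) auto
  show "disc_dist (Moebius_function 0 a z) (Moebius_function 0 a w) \<le> disc_dist z w"
    using M assms by (intro disc_dist_Schwarz_Pick) auto
  show "disc_dist z w \<le> disc_dist (Moebius_function 0 a z) (Moebius_function 0 a w)"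
  proof -
    have "Moebius_function 0 a z \<in> \<D>" "Moebius_function 0 a w \<in> \<D>" using M(3) assms by blast+
    from disc_dist_Schwarz_Pick[OF M(2,4) this] show ?thesis
      using inv[OF assms(2)] inv[OF assms(3)] by simp
  qed
qed

lemma disc_dist_triangle:
  assumes "a \<in> \<D>" "b \<in> \<D>" "c \<in> \<D>"
  shows "disc_dist a c \<le> disc_dist a b + disc_dist b c"
proof -
  let ?M = "Moebius_function 0 b"
  have "?M a \<in> \<D>" "?M c \<in> \<D>" using Moebius_self_map[of b] assms by blast+
  then have "disc_dist (?M a) (?M c) \<le> disc_dist (?M a) (?M b) + disc_dist (?M b) (?M c)"
    using disc_dist_triangle_0 by (simp add: Moebius_function_eq_zero)
  then show ?thesis using assms by (simp add: disc_dist_Moebius)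
qed

section \<open>The hyperbolic metric of a covered domain\<close>

lemma disc_topology: "locally path_connected \<D>" "simply_connected \<D>" "connected \<D>"
  by (auto intro!: open_imp_locally_path_connected convex_imp_simply_connected convex_connected)

lemma covering_lift:
  assumes p: "universal_covering_map p \<Omega>"
    and f: "f holomorphic_on \<D>" "f ` \<D> \<subseteq> \<Omega>"
    and a: "a \<in> \<D>" "b \<in> \<D>" "f a = p b"
  obtains \<phi> where "\<phi> holomorphic_on \<D>" "\<phi> ` \<D> \<subseteq> \<D>" "\<phi> a = b" "\<And>z. z \<in> \<D> \<Longrightarrow> p (\<phi> z) = f z"
proof -
  have cov: "covering_space \<D> p \<Omega>" and hp: "p holomorphic_on \<D>"
    using p by (auto simp: universal_covering_map_def)
  have fO: "f \<in> \<D> \<rightarrow> \<Omega>" using f by auto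
  obtain \<phi> where \<phi>: "continuous_on \<D> \<phi>" "\<phi> \<in> \<D> \<rightarrow> \<D>" "\<phi> a = b" "\<And>z. z \<in> \<D> \<Longrightarrow> p (\<phi> z) = f z"
    by (rule covering_space_lift_strong[OF cov a(2,1) disc_topology(2,1)
          holomorphic_on_imp_continuous_on[OF f(1)] fO a(3)]) blast
  have "\<phi> holomorphic_on \<D>"
    by (rule covering_space_lift_is_holomorphic[OF cov open_ball hp f(1) fO \<phi>(2,1,4)])
  with \<phi> show ?thesis using that by blast
qed

lemma covering_image: "universal_covering_map p \<Omega> \<Longrightarrow> p ` \<D> = \<Omega>"
  by (simp add: universal_covering_map_def covering_space_imp_surjective)

text \<open>
  Lift \<open>q\<close> through \<open>p\<close> to a self-map of the disc and apply Schwarz-Pick to the lift. Exchanging \<open>p\<close>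
  and \<open>q\<close> gives equality, so the density of \<open>\<Omega>\<close> is well defined.
\<close>

lemma covering_density_le:
  assumes p: "universal_covering_map p \<Omega>" and q: "universal_covering_map q \<Omega>"
    and z: "z \<in> \<D>" "w \<in> \<D>" "p z = q w"
  shows "(1 - (cmod w)\<^sup>2) * cmod (deriv q w) \<le> (1 - (cmod z)\<^sup>2) * cmod (deriv p z)"
proof -
  have hp: "p holomorphic_on \<D>" and hq: "q holomorphic_on \<D>"
    using p q by (auto simp: universal_covering_map_def)
  obtain \<phi> where \<phi>: "\<phi> holomorphic_on \<D>" "\<phi> ` \<D> \<subseteq> \<D>" "\<phi> w = z" "\<And>z. z \<in> \<D> \<Longrightarrow> p (\<phi> z) = q z"
    using covering_lift[OF p hq _ z(2,1) z(3)[symmetric]] covering_image[OF q] by blast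
  have "deriv q w = deriv (p \<circ> \<phi>) w"
    by (rule complex_derivative_transform_within_open[of _ "\<D>"])
      (use \<phi> hp hq z in \<open>auto intro: holomorphic_on_compose holomorphic_on_subset\<close>)
  also have "\<dots> = deriv p z * deriv \<phi> w"
    using \<phi> hp z by (subst deriv_chain) (auto intro!: holomorphic_on_imp_differentiable_at[of _ "\<D>"])
  finally have "(1 - (cmod w)\<^sup>2) * cmod (deriv q w) = (cmod (deriv \<phi> w) * (1 - (cmod w)\<^sup>2)) * cmod (deriv p z)"
    by (simp add: norm_mult)
  also have "\<dots> \<le> (1 - (cmod z)\<^sup>2) * cmod (deriv p z)"
    using Schwarz_Pick_deriv[OF \<phi>(1,2) z(2)] \<phi>(3) by (intro mult_right_mono) auto
  finally show ?thesis .
qed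

lemma poincare_density_covering:
  assumes p: "universal_covering_map p \<Omega>" and z: "z \<in> \<D>"
  shows "poincare_density \<Omega> (p z) = 2 / ((1 - (cmod z)\<^sup>2) * cmod (deriv p z))"
  unfolding poincare_density_def
proof (rule the_equality)
  fix l assume "\<exists>q w. universal_covering_map q \<Omega> \<and> w \<in> \<D> \<and> q w = p z \<and> l = 2 / ((1 - (cmod w)\<^sup>2) * cmod (deriv q w))"
  then obtain q w where q: "universal_covering_map q \<Omega>" "w \<in> \<D>" "q w = p z"
    "l = 2 / ((1 - (cmod w)\<^sup>2) * cmod (deriv q w))" by blast
  show "l = 2 / ((1 - (cmod z)\<^sup>2) * cmod (deriv p z))"
    using covering_density_le[OF p q(1) z q(2)] covering_density_le[OF q(1) p q(2) z] q by simp
qed (use assms in blast)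

lemma covering_local_inverse:
  assumes p: "universal_covering_map p \<Omega>" and a: "a \<in> \<D>"
  obtains V q where "open V" "a \<in> V" "V \<subseteq> \<D>" "open (p ` V)" "q holomorphic_on p ` V"
    "\<And>z. z \<in> V \<Longrightarrow> q (p z) = z" "\<And>z. z \<in> V \<Longrightarrow> deriv p z * deriv q (p z) = 1"
proof -
  have cov: "covering_space \<D> p \<Omega>" and hp: "p holomorphic_on \<D>"
    using p by (auto simp: universal_covering_map_def)
  obtain V U q where V: "a \<in> V" "openin (top_of_set \<D>) V" "homeomorphism V U p q"
    by (rule covering_space_local_homeomorphism[OF cov a])
  have oV: "open V" "V \<subseteq> \<D>" using V(2) openin_open_eq[of "\<D>"] by auto
  have inj: "inj_on p V" using V(3) by (metis homeomorphism_def inj_on_inverseI)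
  have hV: "p holomorphic_on V" using hp oV holomorphic_on_subset by blast
  have "open (p ` V)" by (rule open_mapping_thm3[OF hV oV(1) inj])
  then show ?thesis
    using holomorphic_has_inverse[OF hV oV(1) inj] that[OF oV(1) V(1) oV(2)] by metis
qed

text \<open>
  A curve from \<open>a\<close> to \<open>b\<close> is at least as long as \<open>disc_dist b a\<close>. The distance itself is not smooth
  along the curve, so it is replaced by the real part of a holomorphic function that attains it: with
  \<open>f\<close> the automorphism sending \<open>a\<close> to \<open>0\<close> and \<open>b\<close> to a point of the positive radius, put
  \<open>H = Ln ((1 + f) / (1 - f))\<close>. Then \<open>Re (H b) - Re (H a)\<close> is the distance, and by Schwarz-Pick
  \<open>|H'|\<close> is at most the hyperbolic density.

  The finite exceptional set and the majorant \<open>e\<close> of the speed allow \<open>h\<close> to be the lift of a piecewise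
  smooth curve whose length is computed downstairs.
\<close>

lemma disc_path_length:
  fixes h h' :: "real \<Rightarrow> complex"
  assumes h: "continuous_on {0..1} h" "h ` {0..1} \<subseteq> \<D>" and S: "finite S"
    and d: "\<And>t. t \<in> {0<..<1} - S \<Longrightarrow> (h has_vector_derivative h' t) (at t)"
    and e: "\<And>t. t \<in> {0<..<1} - S \<Longrightarrow> 2 * cmod (h' t) / (1 - (cmod (h t))\<^sup>2) \<le> e t"
    and L: "(e has_integral L) {0..1}"
  shows "disc_dist (h 1) (h 0) \<le> L"
proof -
  have "h t \<in> \<D>" if "t \<in> {0..1}" for t using h(2) that by blast
  from this[of 0] this[of 1] have h01: "h 0 \<in> \<D>" "h 1 \<in> \<D>" by simp_all
  define m where "m = Moebius_function 0 (h 0)"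
  \<comment> \<open>The rotation that makes the image of the endpoint real and nonnegative; any rotation does for \<open>0\<close>.\<close>
  define u where "u = (if m (h 1) = 0 then 1 else cnj (m (h 1)) / cmod (m (h 1)))"
  have "cnj x * x / of_real (cmod x) = of_real (cmod x)" if "x \<noteq> 0" for x :: complex
    using complex_norm_square[of x] that by (simp add: power2_eq_square divide_simps mult.commute)
  then have u: "cmod u = 1" "u * m (h 1) = cmod (m (h 1))"
    by (auto simp: u_def norm_divide)
  define f where "f z = u * m z" for z
  have m: "m holomorphic_on \<D>" "m ` \<D> \<subseteq> \<D>"
    unfolding m_def using h01 by (auto intro!: Moebius_function_holomorphic Moebius_function_norm_lt_1)
  have f: "f holomorphic_on \<D>" "f ` \<D> \<subseteq> \<D>"
    unfolding f_def using m u by (auto intro!: holomorphic_intros simp: norm_mult)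
  have f0: "f (h 0) = 0" by (simp add: f_def m_def Moebius_function_eq_zero)
  define H where "H z = Ln (1 + f z) - Ln (1 - f z)" for z
  define H' where "H' z = 2 * deriv f z / (1 - (f z)\<^sup>2)" for z
  have fl: "\<bar>Re (f z)\<bar> < 1" if "z \<in> \<D>" for z
    using f(2) that abs_Re_le_cmod[of "f z"] by fastforce
  have H: "(H has_field_derivative H' z) (at z)" if z: "z \<in> \<D>" for z
  proof -
    have df: "(f has_field_derivative deriv f z) (at z)"
      using f(1) z by (intro holomorphic_derivI[of f "\<D>"]) auto
    have 1: "1 + f z \<notin> \<real>\<^sub>\<le>\<^sub>0" "1 - f z \<notin> \<real>\<^sub>\<le>\<^sub>0"
      using fl[OF z] by (auto simp: complex_nonpos_Reals_iff)
    then have "1 + f z \<noteq> 0" "1 - f z \<noteq> 0" by auto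
    moreover have "1 - (f z)\<^sup>2 = (1 + f z) * (1 - f z)" by (simp add: power2_eq_square algebra_simps)
    ultimately have "H' z = deriv f z / (1 + f z) - (- deriv f z) / (1 - f z)"
      unfolding H'_def by (simp add: divide_simps) (simp add: algebra_simps)
    then show ?thesis
      unfolding H_def using 1 by (auto intro!: derivative_eq_intros df simp: divide_inverse mult.commute)
  qed
  have H'_le: "cmod (H' z) \<le> 2 / (1 - (cmod z)\<^sup>2)" if z: "z \<in> \<D>" for z
  proof -
    have fz: "f z \<in> \<D>" using f z by blast
    have "1 - (cmod (f z))\<^sup>2 \<le> cmod (1 - (f z)\<^sup>2)"
      by (metis norm_one norm_power norm_triangle_ineq2)
    then have "cmod (H' z) \<le> 2 * cmod (deriv f z) / (1 - (cmod (f z))\<^sup>2)"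
      unfolding H'_def norm_divide norm_mult using one_minus_norm_sq_pos[OF fz]
      by (intro frac_le) auto
    also have "\<dots> \<le> 2 / (1 - (cmod z)\<^sup>2)"
      using Schwarz_Pick_deriv[OF f z] one_minus_norm_sq_pos[OF fz] one_minus_norm_sq_pos[OF z]
      by (simp add: field_simps)
    finally show ?thesis .
  qed
  \<comment> \<open>Integrate the derivative of \<open>Re H\<close> along the curve.\<close>
  have cont: "continuous_on {0..1} (\<lambda>t. Re (H (h t)))"
    by (intro continuous_intros continuous_on_compose2[OF _ h])
      (use H in \<open>blast intro: DERIV_continuous_on has_field_derivative_at_within\<close>)
  have der: "((\<lambda>t. Re (H (h t))) has_vector_derivative Re (h' t * H' (h t))) (at t)"
    if "t \<in> {0<..<1} - S" for t
  proof -
    have "h t \<in> \<D>" using h(2) that by (auto simp: image_subset_iff)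
    from field_vector_diff_chain_at[OF d[OF that] H[OF this]]
    show ?thesis unfolding comp_def has_vector_derivative_def
      by (auto intro!: derivative_eq_intros)
  qed
  have int: "((\<lambda>t. Re (h' t * H' (h t))) has_integral (Re (H (h 1)) - Re (H (h 0)))) {0..1}"
    by (rule fundamental_theorem_of_calculus_interior_strong[OF S _ der cont]) auto
  have "Re (H (h 1)) - Re (H (h 0)) \<le> L"
  proof (rule has_integral_le)
    show "((\<lambda>t. if t \<in> {0<..<1} - S then Re (h' t * H' (h t)) else 0) has_integral (Re (H (h 1)) - Re (H (h 0)))) {0..1}"
      by (rule has_integral_spike_finite[of "insert 0 (insert 1 S)", OF _ _ int]) (use S in auto)
    show "((\<lambda>t. if t \<in> {0<..<1} - S then e t else 0) has_integral L) {0..1}"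
      by (rule has_integral_spike_finite[of "insert 0 (insert 1 S)", OF _ _ L]) (use S in auto)
    fix t :: real assume "t \<in> {0..1}"
    have "Re (h' t * H' (h t)) \<le> e t" if t: "t \<in> {0<..<1} - S"
    proof -
      have ht: "h t \<in> \<D>" using h(2) that by (auto simp: image_subset_iff)
      have "Re (h' t * H' (h t)) \<le> cmod (h' t) * cmod (H' (h t))"
        by (metis complex_Re_le_cmod norm_mult)
      also have "\<dots> \<le> cmod (h' t) * (2 / (1 - (cmod (h t))\<^sup>2))"
        by (intro mult_left_mono H'_le ht) auto
      also have "\<dots> \<le> e t" using e[OF t] by (simp add: mult.commute)
      finally show ?thesis .
    qed
    then show "(if t \<in> {0<..<1} - S then Re (h' t * H' (h t)) else 0) \<le> (if t \<in> {0<..<1} - S then e t else 0)"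
      by simp
  qed
  moreover have "Re (H (h 1)) - Re (H (h 0)) = disc_dist (h 1) (h 0)"
  proof -
    define s where "s = cmod (m (h 1))"
    have s: "0 \<le> s" "s < 1" using m(2) h01 by (auto simp: s_def image_subset_iff)
    have "H (h 1) = Ln (of_real (1 + s)) - Ln (of_real (1 - s))"
      unfolding H_def f_def u(2) s_def by simp
    also have "\<dots> = of_real (ln (1 + s) - ln (1 - s))"
      using s by (subst (1 2) Ln_of_real) auto
    finally have "Re (H (h 1)) = ln ((1 + s) / (1 - s))" using s by (simp add: ln_div)
    moreover have "H (h 0) = 0" by (simp add: H_def f0)
    ultimately show ?thesis by (simp add: disc_dist_def artanh_def s_def m_def)
  qed
  ultimately show ?thesis by simp
qed

text \<open>
  The covering map is a local isometry, so a curve in \<open>\<Omega>\<close> and its lift have the same length.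
  The lift is differentiable wherever the curve is, because locally it is the curve followed by a
  holomorphic inverse branch of \<open>p\<close>.
\<close>

lemma lifted_path_length:
  assumes p: "universal_covering_map p \<Omega>" and z: "z \<in> \<D>"
    and c: "valid_path c" "path_image c \<subseteq> \<Omega>" "pathstart c = p z"
    and L: "((\<lambda>t. poincare_density \<Omega> (c t) * cmod (vector_derivative c (at t within {0..1})))
         has_integral L) {0..1}"
  obtains w where "w \<in> \<D>" "p w = pathfinish c" "disc_dist w z \<le> L"
proof -
  have cov: "covering_space \<D> p \<Omega>" using p by (simp add: universal_covering_map_def)
  obtain h where h: "path h" "path_image h \<subseteq> \<D>" "pathstart h = z" "\<And>t. t \<in> {0..1} \<Longrightarrow> p (h t) = c t"
    by (rule covering_space_lift_path_strong[OF cov z valid_path_imp_path[OF c(1)] c(2,3)]) blast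
  obtain S where S: "finite S" "c C1_differentiable_on {0..1} - S"
    using c(1) by (auto simp: valid_path_def piecewise_C1_differentiable_on_def)
  have cont: "continuous_on {0..1} h" and hD: "h ` {0..1} \<subseteq> \<D>"
    using h by (auto simp: path_def path_image_def)
  define h' where "h' t = vector_derivative c (at t) / deriv p (h t)" for t
  have local: "(h has_vector_derivative h' t) (at t)"
      "vector_derivative c (at t within {0..1}) = vector_derivative c (at t)"
      "deriv p (h t) \<noteq> 0"
    if t: "t \<in> {0<..<1} - S" for t
  proof -
    have ht: "h t \<in> \<D>" using hD t by (auto simp: image_subset_iff)
    have cd: "(c has_vector_derivative vector_derivative c (at t)) (at t)"
      using S(2) t by (auto simp: C1_differentiable_on_eq vector_derivative_works[symmetric])
    show "vector_derivative c (at t within {0..1}) = vector_derivative c (at t)"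
      using cd t by (intro vector_derivative_at_within_ivl) auto
    obtain V q where V: "open V" "h t \<in> V" "V \<subseteq> \<D>" "open (p ` V)" "q holomorphic_on p ` V"
        "\<And>z. z \<in> V \<Longrightarrow> q (p z) = z" "\<And>z. z \<in> V \<Longrightarrow> deriv p z * deriv q (p z) = 1"
      by (rule covering_local_inverse[OF p ht]) blast
    have inv: "deriv p (h t) * deriv q (c t) = 1" using V(7)[OF V(2)] h(4)[of t] t by simp
    then show nz: "deriv p (h t) \<noteq> 0" by auto
    have qd: "(q has_field_derivative deriv q (c t)) (at (c t))"
      using V h(4)[of t] t by (intro holomorphic_derivI[of q "p ` V"]) (auto intro: rev_image_eqI)
    have "deriv q (c t) = 1 / deriv p (h t)" using inv nz by (simp add: field_simps)
    then have qc: "(q \<circ> c has_vector_derivative h' t) (at t)"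
      using field_vector_diff_chain_at[OF cd qd] by (simp add: h'_def)
    have ev: "\<forall>\<^sub>F s in at t. h s \<in> V \<and> s \<in> {0..1}"
    proof (rule eventually_conj)
      have "isCont h t" using cont t by (intro continuous_on_interior[of "{0..1}"]) auto
      then show "\<forall>\<^sub>F s in at t. h s \<in> V" unfolding isCont_def by (rule topological_tendstoD) fact+
      have "\<forall>\<^sub>F s in at t. s \<in> {0<..<1}" using t by (intro eventually_at_in_open') auto
      then show "\<forall>\<^sub>F s in at t. s \<in> {0..1}" by (rule eventually_mono) auto
    qed
    show "(h has_vector_derivative h' t) (at t)"
      using qc unfolding has_vector_derivative_def
    proof (rule has_derivative_transform_eventually)
      show "\<forall>\<^sub>F s in at t. (q \<circ> c) s = h s"
        using ev by (rule eventually_mono) (use h(4) V(6) in \<open>fastforce\<close>)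
      show "(q \<circ> c) t = h t" using V(6)[OF V(2)] h(4)[of t] t by simp
    qed auto
  qed
  have "disc_dist (h 1) (h 0) \<le> L"
  proof (rule disc_path_length[OF cont hD S(1) local(1) _ L])
    fix t assume t: "t \<in> {0<..<1} - S"
    have ht: "h t \<in> \<D>" using hD t by (auto simp: image_subset_iff)
    have "poincare_density \<Omega> (c t) = 2 / ((1 - (cmod (h t))\<^sup>2) * cmod (deriv p (h t)))"
      using poincare_density_covering[OF p ht] h(4)[of t] t by simp
    then show "2 * cmod (h' t) / (1 - (cmod (h t))\<^sup>2)
        \<le> poincare_density \<Omega> (c t) * cmod (vector_derivative c (at t within {0..1}))"
      unfolding local(2)[OF t] h'_def by (simp add: norm_divide mult.commute)
  qed
  moreover have "h 1 \<in> \<D>" using hD by (auto simp: image_subset_iff)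
  moreover have "h 0 = z" "p (h 1) = pathfinish c" using h(3) h(4)[of 1] by (auto simp: pathstart_def pathfinish_def)
  ultimately show ?thesis using that by metis
qed

text \<open>
  The image under \<open>p\<close> of the hyperbolic segment from \<open>z\<close> to \<open>w\<close>, parametrised as the Moebius image
  of a Euclidean radius. The automorphism preserves the density, so the speed is that of the radius,
  and its integral is elementary.
\<close>

lemma geodesic_path:
  assumes p: "universal_covering_map p \<Omega>" and z: "z \<in> \<D>" and w: "w \<in> \<D>"
  obtains c where "valid_path c" "path_image c \<subseteq> \<Omega>" "pathstart c = p z" "pathfinish c = p w"
    "((\<lambda>t. poincare_density \<Omega> (c t) * cmod (vector_derivative c (at t within {0..1})))
         has_integral disc_dist w z) {0..1}"
proof -
  have hp: "p holomorphic_on \<D>" using p by (auto simp: universal_covering_map_def)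
  define b where "b = Moebius_function 0 z w"
  define M where "M = Moebius_function 0 (- z)"
  have z1: "cmod (- z) < 1" "cmod z < 1" "cmod w < 1" using z w by auto
  have b: "cmod b < 1" unfolding b_def using z1 by (intro Moebius_function_norm_lt_1) auto
  have M: "M holomorphic_on \<D>" "M ` \<D> \<subseteq> \<D>" "M 0 = z" "M b = w"
    unfolding M_def b_def using z1
    by (auto intro!: Moebius_function_holomorphic Moebius_function_norm_lt_1 Moebius_function_compose)
      (simp add: Moebius_function_simple)
  define \<gamma> where "\<gamma> t = of_real t * b" for t :: real
  have tb: "\<gamma> t \<in> \<D>" if "t \<in> {0..1}" for t
    using that b mult_left_le_one_le[of "cmod b" "\<bar>t\<bar>"] by (auto simp: \<gamma>_def norm_mult)
  have \<gamma>d: "(\<gamma> has_vector_derivative b) (at t within A)" for t A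
    unfolding \<gamma>_def has_vector_derivative_def by (auto intro!: derivative_eq_intros simp: scaleR_conv_of_real)
  have \<gamma>v: "valid_path \<gamma>"
    unfolding valid_path_def 
    by (intro C1_differentiable_imp_piecewise) (auto simp: C1_differentiable_on_def intro!: exI[of _ "\<lambda>_. b"] \<gamma>d)
  have \<gamma>i: "path_image \<gamma> \<subseteq> \<D>" using tb by (auto simp: path_image_def)
  define F where "F = p \<circ> M"
  have F: "F holomorphic_on \<D>" unfolding F_def
    using M hp by (auto intro: holomorphic_on_compose holomorphic_on_subset)
  define c where "c = F \<circ> \<gamma>"
  show ?thesis
  proof
    show "valid_path c" unfolding c_def by (rule valid_path_compose_holomorphic[OF \<gamma>v F open_ball \<gamma>i])
    show "path_image c \<subseteq> \<Omega>"
      using \<gamma>i M(2) covering_image[OF p] by (fastforce simp: c_def F_def path_image_compose)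
    show "pathstart c = p z" "pathfinish c = p w"
      using M by (auto simp: c_def F_def pathstart_def pathfinish_def \<gamma>_def)
    have speed: "poincare_density \<Omega> (c t) * cmod (vector_derivative c (at t within {0..1}))
       = 2 * cmod b / (1 - t\<^sup>2 * (cmod b)\<^sup>2)" if t: "t \<in> {0..1}" for t
    proof -
      have Mt: "M (\<gamma> t) \<in> \<D>" using M(2) tb[OF t] by blast
      have pM: "deriv p (M (\<gamma> t)) \<noteq> 0"
        using covering_local_inverse[OF p Mt] by (metis mult_zero_left zero_neq_one)
      have MM: "cmod (deriv M (\<gamma> t)) * (1 - (cmod (\<gamma> t))\<^sup>2) = 1 - (cmod (M (\<gamma> t)))\<^sup>2"
      proof -
        have g1: "cmod (\<gamma> t) < 1" using tb[OF t] by simp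
        have dM: "deriv M (\<gamma> t) = of_real (1 - (cmod z)\<^sup>2) / (1 - cnj (- z) * \<gamma> t)\<^sup>2"
          unfolding M_def using DERIV_imp_deriv[OF DERIV_Moebius_function[OF z1(1) less_imp_le[OF g1]]] by simp
        have "0 < 1 - (cmod z)\<^sup>2" using one_minus_norm_sq_pos z by blast
        then show ?thesis
          unfolding dM unfolding M_def one_minus_norm_Moebius_squared[OF z1(1) g1]
          by (simp add: norm_divide norm_power del: of_real_diff)
      qed
      have "(F has_field_derivative deriv p (M (\<gamma> t)) * deriv M (\<gamma> t)) (at (\<gamma> t))"
        unfolding F_def using hp M(1) Mt tb[OF t]
        by (intro DERIV_chain holomorphic_derivI[of _ "\<D>"]) auto
      from field_vector_diff_chain_at[OF \<gamma>d this]
      have "(c has_vector_derivative b * (deriv p (M (\<gamma> t)) * deriv M (\<gamma> t))) (at t)"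
        by (simp add: c_def)
      then have "vector_derivative c (at t within {0..1}) = b * (deriv p (M (\<gamma> t)) * deriv M (\<gamma> t))"
        using t by (intro vector_derivative_at_within_ivl) auto
      moreover have "poincare_density \<Omega> (c t) = 2 / ((1 - (cmod (M (\<gamma> t)))\<^sup>2) * cmod (deriv p (M (\<gamma> t))))"
        using poincare_density_covering[OF p Mt] by (simp add: c_def F_def)
      ultimately have "poincare_density \<Omega> (c t) * cmod (vector_derivative c (at t within {0..1}))
        = 2 * cmod b * cmod (deriv M (\<gamma> t)) / (1 - (cmod (M (\<gamma> t)))\<^sup>2)"
        using pM by (simp add: norm_mult)
      also have "\<dots> = 2 * cmod b / (1 - (cmod (\<gamma> t))\<^sup>2)"
      proof -
        have "deriv M (\<gamma> t) \<noteq> 0" using MM one_minus_norm_sq_pos[OF Mt] by auto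
        then show ?thesis unfolding MM[symmetric] by simp
      qed
      finally show ?thesis using t by (simp add: \<gamma>_def norm_mult power_mult_distrib)
    qed
    define A where "A t = ln ((1 + t * cmod b)) - ln (1 - t * cmod b)" for t :: real
    have A: "(A has_real_derivative 2 * cmod b / (1 - t\<^sup>2 * (cmod b)\<^sup>2)) (at t within {0..1})"
      if t: "t \<in> {0..1}" for t
    proof -
      have tb1: "0 \<le> t * cmod b" "t * cmod b < 1"
        using t b mult_left_le_one_le[of "cmod b" t] by auto
      have "1 - t\<^sup>2 * (cmod b)\<^sup>2 = (1 + t * cmod b) * (1 - t * cmod b)"
        by (simp add: power2_eq_square algebra_simps)
      then have "2 * cmod b / (1 - t\<^sup>2 * (cmod b)\<^sup>2) = cmod b / (1 + t * cmod b) + cmod b / (1 - t * cmod b)"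
        using tb1 by (simp add: add_divide_eq_iff divide_simps) (simp add: algebra_simps)
      then show ?thesis unfolding A_def using tb1
        by (auto intro!: derivative_eq_intros simp: divide_inverse)
    qed
    have "((\<lambda>t. 2 * cmod b / (1 - t\<^sup>2 * (cmod b)\<^sup>2)) has_integral A 1 - A 0) {0..1}"
      using A by (intro fundamental_theorem_of_calculus) (auto simp: has_real_derivative_iff_has_vector_derivative)
    moreover have "0 < 1 + cmod b" by (simp add: add_pos_nonneg)
    then have "A 1 - A 0 = disc_dist w z"
      unfolding A_def disc_dist_def artanh_def b_def[symmetric] using b by (subst ln_div) auto
    ultimately have I: "((\<lambda>t. 2 * cmod b / (1 - t\<^sup>2 * (cmod b)\<^sup>2)) has_integral disc_dist w z) {0..1}"
      by simp
    show "((\<lambda>t. poincare_density \<Omega> (c t) * cmod (vector_derivative c (at t within {0..1})))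
         has_integral disc_dist w z) {0..1}"
      by (rule has_integral_eq[OF _ I]) (simp add: speed)
  qed
qed

definition curve_lengths :: "complex set \<Rightarrow> complex \<Rightarrow> complex \<Rightarrow> real set"
  where "curve_lengths \<Omega> z w =
    {L. \<exists>c. valid_path c \<and> path_image c \<subseteq> \<Omega> \<and> pathstart c = z \<and> pathfinish c = w \<and>
      ((\<lambda>t. poincare_density \<Omega> (c t) * cmod (vector_derivative c (at t within {0..1})))
         has_integral L) {0..1}}"

lemma poincare_dist_curve_lengths: "poincare_dist \<Omega> z w = Inf (curve_lengths \<Omega> z w)"
  by (simp add: poincare_dist_def curve_lengths_def)

text \<open>
  The next two lemmas say that \<open>poincare_dist \<Omega> (p z) (p w)\<close> is the distance in the disc from \<open>z\<close> to
  the fibre over \<open>p w\<close>.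
\<close>

lemma poincare_dist_covering_le:
  assumes p: "universal_covering_map p \<Omega>" and z: "z \<in> \<D>" and w: "w \<in> \<D>"
  shows "poincare_dist \<Omega> (p z) (p w) \<le> disc_dist z w"
  unfolding poincare_dist_curve_lengths
proof (rule cInf_lower)
  show "disc_dist z w \<in> curve_lengths \<Omega> (p z) (p w)"
    using geodesic_path[OF p z w] disc_dist_commute[of z w] unfolding curve_lengths_def by (simp, metis)
  show "bdd_below (curve_lengths \<Omega> (p z) (p w))"
  proof (rule bdd_belowI)
    fix L assume "L \<in> curve_lengths \<Omega> (p z) (p w)"
    then show "0 \<le> L"
      using lifted_path_length[OF p z] disc_dist_nonneg[OF _ z]
      unfolding curve_lengths_def by (smt (verit) mem_Collect_eq)
  qed
qed

lemma poincare_dist_covering_ge: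
  assumes p: "universal_covering_map p \<Omega>" and z: "z \<in> \<D>" and w: "w \<in> \<D>"
    and B: "\<And>w'. w' \<in> \<D> \<Longrightarrow> p w' = p w \<Longrightarrow> B \<le> disc_dist z w'"
  shows "B \<le> poincare_dist \<Omega> (p z) (p w)"
  unfolding poincare_dist_curve_lengths
proof (rule cInf_greatest)
  show "curve_lengths \<Omega> (p z) (p w) \<noteq> {}"
    using geodesic_path[OF p z w] unfolding curve_lengths_def by (simp, metis)
  fix L assume "L \<in> curve_lengths \<Omega> (p z) (p w)"
  then obtain c where c: "valid_path c" "path_image c \<subseteq> \<Omega>" "pathstart c = p z" "pathfinish c = p w"
     "((\<lambda>t. poincare_density \<Omega> (c t) * cmod (vector_derivative c (at t within {0..1})))
         has_integral L) {0..1}" unfolding curve_lengths_def by blast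
  obtain w' where w': "w' \<in> \<D>" "p w' = pathfinish c" "disc_dist w' z \<le> L"
    by (rule lifted_path_length[OF p z c(1-3,5)])
  then show "B \<le> L" using B[of w'] c(4) disc_dist_commute[of z w'] by simp
qed

text \<open>
  The identity is a universal covering of the disc, with one-point fibres.
\<close>

lemma poincare_dist_disc:
  assumes z: "z \<in> \<D>" and w: "w \<in> \<D>"
  shows "poincare_dist \<D> z w = disc_dist z w"
proof -
  have id: "universal_covering_map (\<lambda>z. z) \<D>"
    unfolding universal_covering_map_def using holomorphic_on_ident homeomorphism_imp_covering_space[OF homeomorphism_ident] by blast
  show ?thesis
    using poincare_dist_covering_le[OF id z w] poincare_dist_covering_ge[OF id z w, of "disc_dist z w"] by simp
qed

text \<open>
  Lift \<open>p\<close> through itself, once taking \<open>w\<close> to \<open>w'\<close> and once taking \<open>w'\<close> to \<open>w\<close>. Both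
  compositions lift \<open>p\<close> and fix a point, hence are the identity by uniqueness of lifts.
\<close>

lemma deck_transformation_exists:
  assumes p: "universal_covering_map p \<Omega>" and w: "w \<in> \<D>" "w' \<in> \<D>" "p w' = p w"
  obtains \<gamma> where "\<gamma> \<in> deck_group p" "\<gamma> w = w'"
proof -
  have cov: "covering_space \<D> p \<Omega>" and hp: "p holomorphic_on \<D>"
    using p by (auto simp: universal_covering_map_def)
  have im: "p ` \<D> \<subseteq> \<Omega>" using covering_image[OF p] by simp
  obtain \<phi> where \<phi>: "\<phi> holomorphic_on \<D>" "\<phi> ` \<D> \<subseteq> \<D>" "\<phi> w = w'" "\<And>z. z \<in> \<D> \<Longrightarrow> p (\<phi> z) = p z"
    by (rule covering_lift[OF p hp im w(1,2) w(3)[symmetric]]) blast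
  obtain \<psi> where \<psi>: "\<psi> holomorphic_on \<D>" "\<psi> ` \<D> \<subseteq> \<D>" "\<psi> w' = w" "\<And>z. z \<in> \<D> \<Longrightarrow> p (\<psi> z) = p z"
    by (rule covering_lift[OF p hp im w(2,1) w(3)]) blast
  have unique: "f (g z) = z"
    if f: "f holomorphic_on \<D>" "f ` \<D> \<subseteq> \<D>" "\<And>z. z \<in> \<D> \<Longrightarrow> p (f z) = p z"
      and g: "g holomorphic_on \<D>" "g ` \<D> \<subseteq> \<D>" "\<And>z. z \<in> \<D> \<Longrightarrow> p (g z) = p z"
      and a: "a \<in> \<D>" "f (g a) = a" and z: "z \<in> \<D>" for f g a z
  proof (rule covering_space_lift_unique[OF cov, of "f \<circ> g" a "\<lambda>z. z" \<D> p z, unfolded comp_def])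
    show "continuous_on \<D> (\<lambda>x. f (g x))"
      by (rule continuous_on_compose2[OF holomorphic_on_imp_continuous_on[OF f(1)] holomorphic_on_imp_continuous_on[OF g(1)] g(2)])
    show "continuous_on \<D> p" using hp by (rule holomorphic_on_imp_continuous_on)
  qed (use f g a z im disc_topology in \<open>auto simp: image_subset_iff\<close>)
  have "\<psi> (\<phi> z) = z" "\<phi> (\<psi> z) = z" if "z \<in> \<D>" for z
    using unique[OF \<psi>(1,2,4) \<phi>(1,2,4) w(1) _ that] unique[OF \<phi>(1,2,4) \<psi>(1,2,4) w(2) _ that] \<phi>(3) \<psi>(3)
    by auto
  then have "bij_betw \<phi> \<D> \<D>"
    using \<phi>(2) \<psi>(2) by (intro bij_betw_byWitness[of _ \<psi>]) auto
  then have "\<phi> \<in> deck_group p" using \<phi> by (auto simp: deck_group_def disc_automorphisms_def)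
  then show ?thesis using that \<phi>(3) by blast
qed

section \<open>Comparing orbits in the domain and in the disc\<close>

lemma disc_dist_log_bounds:
  assumes "z \<in> \<D>" "w \<in> \<D>"
  defines "q \<equiv> 1 - (cmod (Moebius_function 0 w z))\<^sup>2"
  shows "- ln q \<le> disc_dist z w" "disc_dist z w \<le> ln 4 - ln q"
proof -
  define s where "s = cmod (Moebius_function 0 w z)"
  have s: "0 \<le> s" "s < 1" using Moebius_function_norm_lt_1 assms by (auto simp: s_def)
  have "q = (1 + s) * (1 - s)"
    by (simp add: q_def s_def[symmetric] power2_eq_square algebra_simps)
  with s have q: "0 < q" "q = (1 + s) * (1 - s)" by simp_all
  then have "disc_dist z w = ln ((1 + s)\<^sup>2 / q)"
    using s by (simp add: disc_dist_def artanh_def s_def[symmetric] power2_eq_square)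
  also have "\<dots> = ln ((1 + s)\<^sup>2) - ln q" using s q by (subst ln_div) auto
  finally have e: "disc_dist z w = ln ((1 + s)\<^sup>2) - ln q" .
  have "0 \<le> ln ((1 + s)\<^sup>2)" using s by (simp add: ln_ge_zero one_le_power)
  then show "- ln q \<le> disc_dist z w" using e by simp
  have "(1 + s)\<^sup>2 \<le> 2\<^sup>2" using s by (intro power_mono) auto
  then have "ln ((1 + s)\<^sup>2) \<le> ln 4" using s by (intro ln_mono) auto
  then show "disc_dist z w \<le> ln 4 - ln q" using e by simp
qed

lemma norm_one_minus_cnj_mult:
  assumes "cmod \<tau> = 1"
  shows "cmod (1 - cnj \<tau> * z) = cmod (z - \<tau>)"
proof -
  have "cnj \<tau> * \<tau> = 1" using complex_norm_square[of \<tau>] assms by (simp add: mult.commute)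
  then have "1 - cnj \<tau> * z = cnj \<tau> * (\<tau> - z)" by (simp add: algebra_simps)
  then show ?thesis using assms by (simp add: norm_mult norm_minus_commute)
qed

text \<open>
  As \<open>z\<close> approaches the boundary point \<open>\<tau>\<close>, the only way for \<open>a\<close> to be much closer to \<open>z\<close> than the
  origin is that \<open>1 - cnj a * z\<close> is small, that is, that \<open>a\<close> is itself near \<open>\<tau>\<close>.
\<close>

lemma disc_dist_away_from_boundary_point:
  assumes \<tau>: "cmod \<tau> = 1" and \<epsilon>: "0 < \<epsilon>" and z: "z \<in> \<D>" "cmod (z - \<tau>) \<le> \<epsilon> / 2"
    and a: "a \<in> \<D>" "\<epsilon> \<le> cmod (a - \<tau>)"
  shows "disc_dist z 0 \<le> disc_dist z a + ln (16 / \<epsilon>\<^sup>2)"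
proof -
  have z1: "0 < 1 - (cmod z)\<^sup>2" and a1: "0 < 1 - (cmod a)\<^sup>2"
    using one_minus_norm_sq_pos z a by blast+
  have "cmod (1 - cnj a * \<tau>) = cmod (cnj (1 - cnj a * \<tau>))" by (simp only: complex_mod_cnj)
  also have "\<dots> = cmod (a - \<tau>)" using norm_one_minus_cnj_mult[OF \<tau>, of a] by (simp add: mult.commute)
  finally have "cmod (1 - cnj a * \<tau>) = cmod (a - \<tau>)" .
  moreover have "cmod (cnj a * (z - \<tau>)) \<le> \<epsilon> / 2"
  proof -
    have "cmod a * cmod (z - \<tau>) \<le> 1 * (\<epsilon> / 2)" using a z by (intro mult_mono) auto
    then show ?thesis by (simp add: norm_mult)
  qed
  moreover have "1 - cnj a * \<tau> = (1 - cnj a * z) + cnj a * (z - \<tau>)" by (simp add: algebra_simps)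
  ultimately have D: "\<epsilon> / 2 \<le> cmod (1 - cnj a * z)"
    using a(2) norm_triangle_ineq[of "1 - cnj a * z" "cnj a * (z - \<tau>)"] by simp
  define q where "q = 1 - (cmod (Moebius_function 0 a z))\<^sup>2"
  have q_eq: "q = (1 - (cmod z)\<^sup>2) * (1 - (cmod a)\<^sup>2) / (cmod (1 - cnj a * z))\<^sup>2"
    unfolding q_def using a z by (intro one_minus_norm_Moebius_squared) auto
  have D2: "(\<epsilon> / 2)\<^sup>2 \<le> (cmod (1 - cnj a * z))\<^sup>2" using D \<epsilon> by (intro power_mono) auto
  have q0: "0 < q" unfolding q_eq using z1 a1 D \<epsilon>
    by (intro divide_pos_pos mult_pos_pos zero_less_power) linarith+
  have "q \<le> (1 - (cmod z)\<^sup>2) * 1 / (\<epsilon> / 2)\<^sup>2"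
    unfolding q_eq using z1 a1 D2 \<epsilon> by (intro frac_le mult_left_mono) auto
  also have "\<dots> = (1 - (cmod z)\<^sup>2) * (4 / \<epsilon>\<^sup>2)" by (simp add: power_divide)
  finally have "ln q \<le> ln ((1 - (cmod z)\<^sup>2) * (4 / \<epsilon>\<^sup>2))" using q0 by (intro ln_mono)
  also have "\<dots> = ln (1 - (cmod z)\<^sup>2) + ln (4 / \<epsilon>\<^sup>2)" using z1 \<epsilon> by (intro ln_mult_pos) auto
  finally have "- ln (1 - (cmod z)\<^sup>2) \<le> disc_dist z a + ln (4 / \<epsilon>\<^sup>2)"
    using disc_dist_log_bounds(1)[OF z(1) a(1)] by (simp add: q_def)
  moreover have "disc_dist z 0 \<le> ln 4 - ln (1 - (cmod z)\<^sup>2)"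
    using disc_dist_log_bounds(2)[OF z(1), of 0] by (simp add: Moebius_function_simple)
  moreover have "ln (16 / \<epsilon>\<^sup>2) = ln 4 + ln (4 / \<epsilon>\<^sup>2)"
    using ln_mult_pos[of 4 "4 / \<epsilon>\<^sup>2"] \<epsilon> by simp
  ultimately show ?thesis by linarith
qed

lemma orbit_separated:
  assumes "\<tau> \<notin> limit_set (deck_group p)" "cmod \<tau> = 1"
  obtains \<epsilon> where "0 < \<epsilon>" "\<And>\<gamma>. \<gamma> \<in> deck_group p \<Longrightarrow> \<epsilon> \<le> cmod (\<gamma> 0 - \<tau>)"
proof -
  have "\<tau> \<notin> closure {\<gamma> 0 |\<gamma>. \<gamma> \<in> deck_group p}"
    using assms by (simp add: limit_set_def)
  then show ?thesis using that unfolding closure_approachable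
    by (auto simp: dist_norm not_less)
qed

lemma bigo_1_cong_bounded_difference:
  fixes f h :: "nat \<Rightarrow> real"
  assumes "\<forall>\<^sub>F n in sequentially. \<bar>f n - h n\<bar> \<le> C"
  shows "f \<in> O(\<lambda>_. 1) \<longleftrightarrow> h \<in> O(\<lambda>_. 1)"
proof -
  have d: "(\<lambda>n. f n - h n) \<in> O(\<lambda>_. 1)"
    by (rule bigoI[of _ C]) (use assms in simp)
  have "f = (\<lambda>n. h n + (f n - h n))" "h = (\<lambda>n. f n - (f n - h n))" by auto
  then show ?thesis using sum_in_bigo[OF _ d] by metis
qed

lemma funpow_in_disc: "G ` \<D> \<subseteq> \<D> \<Longrightarrow> z \<in> \<D> \<Longrightarrow> (G ^^ n) z \<in> \<D>"
  by (induction n) (auto simp: image_subset_iff)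

lemma funpow_lift:
  assumes "G ` \<D> \<subseteq> \<D>" "\<forall>z\<in>\<D>. p (G z) = g (p z)" "z \<in> \<D>"
  shows "p ((G ^^ n) z) = (g ^^ n) (p z)"
  using assms funpow_in_disc[OF assms(1,3)] by (induction n) auto

lemma disc_dist_funpow:
  assumes "G holomorphic_on \<D>" "G ` \<D> \<subseteq> \<D>" "z \<in> \<D>" "w \<in> \<D>"
  shows "disc_dist ((G ^^ n) z) ((G ^^ n) w) \<le> disc_dist z w"
proof (induction n)
  case (Suc n)
  have "disc_dist (G ((G ^^ n) z)) (G ((G ^^ n) w)) \<le> disc_dist ((G ^^ n) z) ((G ^^ n) w)"
    using assms by (intro disc_dist_Schwarz_Pick funpow_in_disc)
  then show ?case using Suc by simp
qed simp

text \<open>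
  Base points are immaterial up to a bounded error: iterates do not increase \<open>disc_dist\<close>, and the
  triangle inequality does the rest. This allows one convenient orbit to be used throughout.
\<close>

lemma extremal_rate_disc_iff:
  assumes G: "G holomorphic_on \<D>" "G ` \<D> \<subseteq> \<D>" and z0: "z0 \<in> \<D>"
  shows "extremal_hyperbolic_rate \<D> G \<alpha> \<longleftrightarrow>
    (\<lambda>n. disc_dist ((G ^^ n) z0) 0 - real n * ln (1 / \<alpha>)) \<in> O(\<lambda>_. 1)"
proof -
  have "(\<lambda>n. poincare_dist \<D> ((G ^^ n) z) w - real n * ln (1 / \<alpha>)) \<in> O(\<lambda>_. 1) \<longleftrightarrow>
    (\<lambda>n. disc_dist ((G ^^ n) z0) 0 - real n * ln (1 / \<alpha>)) \<in> O(\<lambda>_. 1)"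
    if z: "z \<in> \<D>" and w: "w \<in> \<D>" for z w
  proof (rule bigo_1_cong_bounded_difference[of _ _ "disc_dist z z0 + disc_dist w 0"], intro always_eventually allI)
    fix n
    have D: "(G ^^ n) z \<in> \<D>" "(G ^^ n) z0 \<in> \<D>" "0 \<in> \<D>" using funpow_in_disc[OF G(2)] z z0 by auto
    show "\<bar>poincare_dist \<D> ((G ^^ n) z) w - real n * ln (1 / \<alpha>) -
        (disc_dist ((G ^^ n) z0) 0 - real n * ln (1 / \<alpha>))\<bar> \<le> disc_dist z z0 + disc_dist w 0"
      using disc_dist_funpow[OF G z z0, of n] poincare_dist_disc[OF D(1) w]
        disc_dist_triangle[OF D(1,2) w] disc_dist_triangle[OF D(2) D(3) w]
        disc_dist_triangle[OF D(2) D(1) D(3)] disc_dist_triangle[OF D(1) w D(3)]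
        disc_dist_commute[of w 0] disc_dist_commute[of "(G ^^ n) z" "(G ^^ n) z0"]
      by (simp add: abs_le_iff) 
  qed
  then show ?thesis unfolding extremal_hyperbolic_rate_def using z0 by blast
qed

text \<open>
  The fibre over \<open>p w\<close> is the deck orbit of \<open>w\<close>, which follows the deck orbit of \<open>0\<close> at bounded
  distance. The latter stays at Euclidean distance \<open>\<epsilon>\<close> from \<open>\<tau>\<close>, so for an orbit tending to \<open>\<tau>\<close> the
  origin is, up to a bounded error, the nearest point of its fibre. Hence the distances in \<open>\<Omega>\<close>
  and in the disc differ by a bounded amount.
\<close>

lemma extremal_rate_covering_iff:
  assumes p: "universal_covering_map p \<Omega>"
    and G: "G holomorphic_on \<D>" "G ` \<D> \<subseteq> \<D>" "\<forall>z\<in>\<D>. p (G z) = g (p z)" and z0: "z0 \<in> \<D>"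
    and \<tau>: "cmod \<tau> = 1" "(\<lambda>n. (G ^^ n) z0) \<longlonglongrightarrow> \<tau>" "\<tau> \<notin> limit_set (deck_group p)"
  shows "extremal_hyperbolic_rate \<Omega> g \<alpha> \<longleftrightarrow>
    (\<lambda>n. disc_dist ((G ^^ n) z0) 0 - real n * ln (1 / \<alpha>)) \<in> O(\<lambda>_. 1)"
proof -
  obtain \<epsilon> where \<epsilon>: "0 < \<epsilon>" "\<And>\<gamma>. \<gamma> \<in> deck_group p \<Longrightarrow> \<epsilon> \<le> cmod (\<gamma> 0 - \<tau>)"
    using orbit_separated[OF \<tau>(3,1)] by blast
  have near: "\<forall>\<^sub>F n in sequentially. cmod ((G ^^ n) z0 - \<tau>) < \<epsilon> / 2"
    using tendstoD[OF \<tau>(2), of "\<epsilon> / 2"] \<epsilon> by (simp add: dist_norm)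
  have "(\<lambda>n. poincare_dist \<Omega> ((g ^^ n) (p z)) (p w) - real n * ln (1 / \<alpha>)) \<in> O(\<lambda>_. 1) \<longleftrightarrow>
    (\<lambda>n. disc_dist ((G ^^ n) z0) 0 - real n * ln (1 / \<alpha>)) \<in> O(\<lambda>_. 1)"
    if z: "z \<in> \<D>" and w: "w \<in> \<D>" for z w
  proof (rule bigo_1_cong_bounded_difference[of _ _ "disc_dist z z0 + disc_dist w 0 + \<bar>ln (16 / \<epsilon>\<^sup>2)\<bar>"],
      rule eventually_mono[OF near])
    fix n assume n: "cmod ((G ^^ n) z0 - \<tau>) < \<epsilon> / 2"
    define a b where "a = (G ^^ n) z" and "b = (G ^^ n) z0"
    have D: "a \<in> \<D>" "b \<in> \<D>" "0 \<in> \<D>" using funpow_in_disc[OF G(2)] z z0 by (auto simp: a_def b_def)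
    have ab: "disc_dist a b \<le> disc_dist z z0" using disc_dist_funpow[OF G(1,2) z z0] by (simp add: a_def b_def)
    have "disc_dist b 0 - disc_dist z z0 - disc_dist w 0 - \<bar>ln (16 / \<epsilon>\<^sup>2)\<bar> \<le> disc_dist a w'"
      if w': "w' \<in> \<D>" "p w' = p w" for w'
    proof -
      obtain \<gamma> where \<gamma>: "\<gamma> \<in> deck_group p" "\<gamma> w = w'" by (rule deck_transformation_exists[OF p w w'])
      then have \<gamma>': "\<gamma> holomorphic_on \<D>" "\<gamma> ` \<D> \<subseteq> \<D>"
        by (auto simp: deck_group_def disc_automorphisms_def bij_betw_def)
      then have \<gamma>0: "\<gamma> 0 \<in> \<D>" using D(3) by blast
      have "disc_dist w' (\<gamma> 0) \<le> disc_dist w 0" using disc_dist_Schwarz_Pick[OF \<gamma>' w D(3)] \<gamma> by simp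
      moreover have "disc_dist b 0 \<le> disc_dist b (\<gamma> 0) + ln (16 / \<epsilon>\<^sup>2)"
        using n by (intro disc_dist_away_from_boundary_point[OF \<tau>(1) \<epsilon>(1) D(2) _ \<gamma>0 \<epsilon>(2)[OF \<gamma>(1)]]) (simp add: b_def)
      ultimately show ?thesis
        using disc_dist_triangle[OF D(2,1) \<gamma>0] disc_dist_triangle[OF D(1) w'(1) \<gamma>0] ab
          disc_dist_commute[of a b] by linarith
    qed
    from poincare_dist_covering_ge[OF p D(1) w this]
    have ge: "disc_dist b 0 - disc_dist z z0 - disc_dist w 0 - \<bar>ln (16 / \<epsilon>\<^sup>2)\<bar> \<le> poincare_dist \<Omega> (p a) (p w)" .
    moreover have "poincare_dist \<Omega> (p a) (p w) \<le> disc_dist b 0 + disc_dist z z0 + disc_dist w 0"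
      using poincare_dist_covering_le[OF p D(1) w] disc_dist_triangle[OF D(1,2) w]
        disc_dist_triangle[OF D(2,3) w] ab disc_dist_commute[of w 0] by linarith
    moreover have "p a = (g ^^ n) (p z)" unfolding a_def by (rule funpow_lift[OF G(2,3) z])
    ultimately show "\<bar>poincare_dist \<Omega> ((g ^^ n) (p z)) (p w) - real n * ln (1 / \<alpha>) -
        (disc_dist ((G ^^ n) z0) 0 - real n * ln (1 / \<alpha>))\<bar> \<le> disc_dist z z0 + disc_dist w 0 + \<bar>ln (16 / \<epsilon>\<^sup>2)\<bar>"
      by (simp add: abs_le_iff b_def)
  qed
  then show ?thesis unfolding extremal_hyperbolic_rate_def covering_image[OF p, symmetric] using z0 by blast
qed

section \<open>Growth of orbits and the Herglotz measure\<close>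

text \<open>
  For a geometric sequence \<open>y\<^sub>n = \<alpha>^n * y\<^sub>0\<close>, the sums of \<open>y\<^sub>n / (1 + y\<^sub>n)\<close> and of
  its square both count, up to constants, how many terms exceed \<open>1\<close>, which is about \<open>ln y\<^sub>0\<close>. The
  next two inequalities bound a summand from above and from below by a difference of consecutive terms,
  so that the sums telescope.
\<close>

lemma ln_diff_ge_ratio:
  fixes y \<alpha> :: real
  assumes "0 \<le> y" "0 < \<alpha>" "\<alpha> < 1"
  shows "(1 - \<alpha>) * (y / (1 + y)) \<le> ln (1 + y) - ln (1 + \<alpha> * y)"
proof -
  have p: "0 < 1 + y" "0 < 1 + \<alpha> * y" using assms by (auto intro: add_pos_nonneg)
  have "ln ((1 + \<alpha> * y) / (1 + y)) \<le> (1 + \<alpha> * y) / (1 + y) - 1"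
    using p by (intro ln_le_minus_one) auto
  moreover have "(1 + \<alpha> * y) / (1 + y) - 1 = - ((1 - \<alpha>) * (y / (1 + y)))"
    using p by (simp add: field_simps)
  ultimately show ?thesis using p by (simp add: ln_div)
qed

lemma ln_diff_le_ratio_squared:
  fixes y \<alpha> :: real
  assumes "0 \<le> y" "0 < \<alpha>" "\<alpha> < 1"
  shows "ln (1 + y\<^sup>2) - ln (1 + (\<alpha> * y)\<^sup>2) \<le> 2 / \<alpha>\<^sup>2 * (y / (1 + y))\<^sup>2"
proof -
  have p: "0 < 1 + y\<^sup>2" "0 < 1 + (\<alpha> * y)\<^sup>2" "0 < 1 + y" using assms by (auto intro: add_pos_nonneg)
  have a: "\<alpha>\<^sup>2 \<le> 1" "0 < \<alpha>\<^sup>2" using assms by (auto simp: power_le_one)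
  have "ln (1 + y\<^sup>2) - ln (1 + (\<alpha> * y)\<^sup>2) = ln ((1 + y\<^sup>2) / (1 + (\<alpha> * y)\<^sup>2))" using p by (simp add: ln_div)
  also have "\<dots> \<le> (1 + y\<^sup>2) / (1 + (\<alpha> * y)\<^sup>2) - 1" using p by (intro ln_le_minus_one) auto
  also have "\<dots> = (1 - \<alpha>\<^sup>2) * y\<^sup>2 / (1 + (\<alpha> * y)\<^sup>2)" using p by (simp add: field_simps power_mult_distrib)
  also have "\<dots> \<le> 1 * y\<^sup>2 / (\<alpha>\<^sup>2 * (1 + y\<^sup>2))"
  proof -
    have "0 < \<alpha>\<^sup>2 * (1 + y\<^sup>2)" using a(2) p(1) by (rule mult_pos_pos)
    moreover have "\<alpha>\<^sup>2 * (1 + y\<^sup>2) \<le> 1 + (\<alpha> * y)\<^sup>2"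
      using a by (simp add: distrib_left power_mult_distrib)
    ultimately show ?thesis using a by (intro frac_le mult_right_mono) auto
  qed
  also have "\<dots> \<le> y\<^sup>2 / (\<alpha>\<^sup>2 * ((1 + y)\<^sup>2 / 2))"
  proof -
    have "(1 + y)\<^sup>2 \<le> 2 * (1 + y\<^sup>2)" using zero_le_power2[of "1 - y"] by (simp add: power2_eq_square algebra_simps)
    then show ?thesis using a p by (simp only: mult_1) (intro divide_left_mono mult_left_mono mult_pos_pos, auto)
  qed
  also have "\<dots> = 2 / \<alpha>\<^sup>2 * (y / (1 + y))\<^sup>2" by (simp add: power_divide)
  finally show ?thesis .
qed

text \<open>
  The normalised sequence \<open>y n = x n * \<alpha> ^ n\<close> is nondecreasing and equals \<open>x 0\<close> times the product of the
  factors \<open>1 + \<alpha> * a k\<close>. Such a product lies between \<open>1 + s\<close> and \<open>exp s\<close>, where \<open>s\<close> is the sum of the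
  numbers \<open>\<alpha> * a k\<close>.
\<close>

lemma growth_bounded_iff_summable:
  fixes x a :: "nat \<Rightarrow> real"
  assumes \<alpha>: "0 < \<alpha>" "\<alpha> < 1" and x0: "0 < x 0" and a: "\<And>n. 0 \<le> a n"
    and x: "\<And>n. x (Suc n) = x n / \<alpha> * (1 + \<alpha> * a n)"
  shows "x 0 \<le> x n * \<alpha> ^ n"
    and "(\<lambda>n. ln (x n) - real n * ln (1 / \<alpha>)) \<in> O(\<lambda>_. 1) \<longleftrightarrow> summable a"
    and "summable a \<Longrightarrow> \<exists>C>0. \<forall>n. x n * \<alpha> ^ n \<le> C"
proof -
  define y where "y n = x n * \<alpha> ^ n" for n
  have y0: "y 0 = x 0" by (simp add: y_def)
  have ySuc: "y (Suc n) = y n * (1 + \<alpha> * a n)" for n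
    using \<alpha> by (simp add: y_def x field_simps)
  have ypos: "0 < y n" for n
    by (induction n) (use x0 \<alpha> a in \<open>auto simp: y0 ySuc intro!: mult_pos_pos add_pos_nonneg\<close>)
  have lower: "y 0 * (1 + \<alpha> * (\<Sum>k<n. a k)) \<le> y n" for n
  proof (induction n)
    case (Suc n)
    have s: "0 \<le> \<alpha> * (\<Sum>k<n. a k)" using \<alpha> a by (simp add: sum_nonneg)
    have "1 + \<alpha> * (\<Sum>k<Suc n. a k) \<le> (1 + \<alpha> * (\<Sum>k<n. a k)) * (1 + \<alpha> * a n)"
      using mult_nonneg_nonneg[OF s, of "\<alpha> * a n"] \<alpha> a by (simp add: algebra_simps)
    then have "y 0 * (1 + \<alpha> * (\<Sum>k<Suc n. a k)) \<le> y 0 * (1 + \<alpha> * (\<Sum>k<n. a k)) * (1 + \<alpha> * a n)"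
      using ypos[of 0] by (simp add: mult.assoc)
    also have "\<dots> \<le> y (Suc n)" unfolding ySuc using Suc \<alpha> a by (intro mult_right_mono) (auto intro: add_nonneg_nonneg)
    finally show ?case .
  qed simp
  have upper: "y n \<le> y 0 * exp (\<alpha> * (\<Sum>k<n. a k))" for n
  proof (induction n)
    case (Suc n)
    have "y (Suc n) \<le> y 0 * exp (\<alpha> * (\<Sum>k<n. a k)) * exp (\<alpha> * a n)"
      unfolding ySuc using Suc exp_ge_add_one_self[of "\<alpha> * a n"] \<alpha> a ypos[of 0]
      by (intro mult_mono) auto
    then show ?case by (simp add: exp_add[symmetric] distrib_left mult.assoc)
  qed simp
  have y_ge: "y 0 \<le> y n" for n
  proof -
    have "0 \<le> y 0 * (\<alpha> * (\<Sum>k<n. a k))" using \<alpha> a ypos[of 0] by (simp add: sum_nonneg)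
    then show ?thesis using lower[of n] by (simp add: algebra_simps)
  qed
  then show "x 0 \<le> x n * \<alpha> ^ n" by (simp add: y_def)
  show bd: "\<exists>C>0. \<forall>n. x n * \<alpha> ^ n \<le> C" if "summable a"
  proof (intro exI conjI allI)
    fix n
    have "y 0 * exp (\<alpha> * (\<Sum>k<n. a k)) \<le> y 0 * exp (\<alpha> * suminf a)"
      using that a \<alpha> ypos[of 0] by (intro mult_left_mono iffD2[OF exp_le_cancel_iff] sum_le_suminf) auto
    then show "x n * \<alpha> ^ n \<le> y 0 * exp (\<alpha> * suminf a)" using upper[of n] by (simp add: y_def)
  qed (use ypos[of 0] in simp)
  have ln_y: "ln (x n) - real n * ln (1 / \<alpha>) = ln (y n)" for n
  proof -
    have "0 < x n" using ypos[of n] \<alpha> by (simp add: y_def zero_less_mult_iff)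
    then show ?thesis using \<alpha> by (simp add: y_def ln_mult_pos ln_realpow ln_div)
  qed
  show "(\<lambda>n. ln (x n) - real n * ln (1 / \<alpha>)) \<in> O(\<lambda>_. 1) \<longleftrightarrow> summable a"
    unfolding ln_y
  proof
    assume "summable a"
    then obtain C where C: "\<And>n. y n \<le> C" using bd by (auto simp: y_def)
    show "(\<lambda>n. ln (y n)) \<in> O(\<lambda>_. 1)"
    proof (rule bigoI[of _ "\<bar>ln (y 0)\<bar> + \<bar>ln C\<bar>"], intro always_eventually allI)
      fix n
      have "ln (y 0) \<le> ln (y n)" "ln (y n) \<le> ln C" using C[of n] y_ge[of n] ypos[of 0] ypos[of n] by (auto intro!: ln_mono)
      then show "norm (ln (y n)) \<le> (\<bar>ln (y 0)\<bar> + \<bar>ln C\<bar>) * norm (1::real)" by simp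
    qed
  next
    assume "(\<lambda>n. ln (y n)) \<in> O(\<lambda>_. 1)"
    then obtain c where "\<forall>\<^sub>F n in sequentially. \<bar>ln (y n)\<bar> \<le> c" by (auto elim!: landau_o.bigE)
    then obtain N where N: "\<And>n. n \<ge> N \<Longrightarrow> \<bar>ln (y n)\<bar> \<le> c" by (auto simp: eventually_sequentially)
    have yc: "y n \<le> exp c" if "n \<ge> N" for n
      using N[OF that] ypos[of n] by (metis abs_le_D1 exp_le_cancel_iff exp_ln)
    show "summable a"
    proof (rule summableI_nonneg_bounded[of _ "exp c / (y 0 * \<alpha>)"])
      fix n
      have "(\<Sum>k<n. a k) \<le> (\<Sum>k<max n N. a k)" using a by (intro sum_mono2) auto
      then have "y 0 * (1 + \<alpha> * (\<Sum>k<n. a k)) \<le> y 0 * (1 + \<alpha> * (\<Sum>k<max n N. a k))"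
        using \<alpha> ypos[of 0] by simp
      also have "\<dots> \<le> exp c" using lower[of "max n N"] yc[of "max n N"] by linarith
      finally have "y 0 * \<alpha> * (\<Sum>k<n. a k) \<le> exp c" using ypos[of 0] by (simp add: algebra_simps)
      then show "(\<Sum>k<n. a k) \<le> exp c / (y 0 * \<alpha>)"
        using \<alpha> ypos[of 0] by (simp add: field_simps)
    qed (use a in auto)
  qed
qed

lemma Re_Cayley: "Re ((a + b) / (a - b)) = ((cmod a)\<^sup>2 - (cmod b)\<^sup>2) / (cmod (a - b))\<^sup>2"
proof -
  have "Re ((a + b) / (a - b)) = Re ((a + b) * cnj (a - b)) / (cmod (a - b))\<^sup>2"
    by (subst complex_div_cnj) simp
  also have "Re ((a + b) * cnj (a - b)) = (cmod a)\<^sup>2 - (cmod b)\<^sup>2"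
    unfolding cmod_power2 by (simp add: power2_eq_square algebra_simps)
  finally show ?thesis .
qed

lemma circle_measurable:
  assumes "sets \<sigma> = sets (restrict_space borel (sphere 0 1 - {\<tau>}))"
    and "f \<in> borel_measurable borel"
  shows "f \<in> borel_measurable (\<sigma> :: complex measure)"
  using measurable_restrict_space1[OF assms(2)] measurable_cong_sets[OF assms(1) refl] by blast

text \<open>
  For \<open>\<zeta>\<close> on the circle, the square of this number is the quotient of the Poisson kernels at \<open>z\<close> with
  poles \<open>\<zeta>\<close> and \<open>\<tau>\<close>.
\<close>

definition boundary_ratio :: "complex \<Rightarrow> complex \<Rightarrow> complex \<Rightarrow> real"
  where "boundary_ratio \<tau> z \<zeta> = cmod (z - \<tau>) / cmod (\<zeta> - z)"

context
  fixes \<sigma> :: "complex measure" and \<tau> :: complex and z :: "nat \<Rightarrow> complex" and M \<alpha> :: real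
  assumes sets: "sets \<sigma> = sets (restrict_space borel (sphere 0 1 - {\<tau>}))"
    and fin: "finite_measure \<sigma>" and \<tau>: "cmod \<tau> = 1"
    and \<alpha>: "0 < \<alpha>" "\<alpha> < 1"
    and M: "1 < M" and z: "\<And>n. z n \<in> stolz_region \<tau> M"
begin

lemma space_circle: "\<zeta> \<in> space \<sigma> \<longleftrightarrow> cmod \<zeta> = 1 \<and> \<zeta> \<noteq> \<tau>"
  using sets_eq_imp_space_eq[OF sets] by (auto simp: space_restrict_space)

lemma stolz: "cmod (z n) < 1" "0 < cmod (z n - \<tau>)" "cmod (z n - \<tau>) < M * (1 - cmod (z n))"
  "1 - cmod (z n) \<le> cmod (z n - \<tau>)"
proof -
  show "cmod (z n) < 1" "cmod (z n - \<tau>) < M * (1 - cmod (z n))"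
    using z[of n] by (auto simp: stolz_region_def)
  then show "0 < cmod (z n - \<tau>)" using \<tau> by auto
  show "1 - cmod (z n) \<le> cmod (z n - \<tau>)"
    using norm_triangle_ineq2[of \<tau> "z n"] \<tau> by (simp add: norm_minus_commute)
qed

text \<open>
  In a Stolz region at \<open>\<tau>\<close> both \<open>|z - \<tau>|\<close> and \<open>|\<zeta> - \<tau>|\<close> are at most a multiple of \<open>|\<zeta> - z|\<close>, so
  \<open>|\<zeta> - z|\<close> is comparable to their sum.
\<close>

lemma ratio_bounds:
  assumes "\<zeta> \<in> space \<sigma>"
  shows "0 < cmod (\<zeta> - \<tau>)" "0 \<le> boundary_ratio \<tau> (z n) \<zeta>" "boundary_ratio \<tau> (z n) \<zeta> \<le> M"
    "boundary_ratio \<tau> (z n) \<zeta> \<le> (1 + 2 * M) * (cmod (z n - \<tau>) / (cmod (\<zeta> - \<tau>) + cmod (z n - \<tau>)))"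
    "cmod (z n - \<tau>) / (cmod (\<zeta> - \<tau>) + cmod (z n - \<tau>)) \<le> boundary_ratio \<tau> (z n) \<zeta>"
proof -
  let ?d = "cmod (\<zeta> - \<tau>)" and ?\<delta> = "cmod (z n - \<tau>)" and ?r = "cmod (\<zeta> - z n)"
  show d: "0 < ?d" using assms by (simp add: space_circle)
  show "0 \<le> boundary_ratio \<tau> (z n) \<zeta>" by (simp add: boundary_ratio_def)
  have "1 - cmod (z n) \<le> ?r" using assms norm_triangle_ineq2[of \<zeta> "z n"] by (simp add: space_circle)
  then have "M * (1 - cmod (z n)) \<le> M * ?r" using M by (intro mult_left_mono) auto
  then have \<delta>r: "?\<delta> \<le> M * ?r" using stolz(3)[of n] by linarith
  then have r: "0 < ?r" using stolz(2)[of n] M by (metis less_le_trans zero_less_mult_pos less_trans zero_less_one)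
  show "boundary_ratio \<tau> (z n) \<zeta> \<le> M" using \<delta>r r by (simp add: boundary_ratio_def field_simps)
  have "?d \<le> ?r + ?\<delta>" using norm_triangle_ineq[of "\<zeta> - z n" "z n - \<tau>"] by simp
  then have "?d + ?\<delta> \<le> (1 + 2 * M) * ?r" using \<delta>r by (simp add: algebra_simps)
  then have "(?d + ?\<delta>) / (1 + 2 * M) \<le> ?r" using M by (simp add: divide_le_eq mult.commute)
  then have "boundary_ratio \<tau> (z n) \<zeta> \<le> ?\<delta> / ((?d + ?\<delta>) / (1 + 2 * M))"
    unfolding boundary_ratio_def using r d M
    by (intro divide_left_mono mult_pos_pos divide_pos_pos add_pos_nonneg) auto
  then show "boundary_ratio \<tau> (z n) \<zeta> \<le> (1 + 2 * M) * (?\<delta> / (?d + ?\<delta>))" by (simp add: mult.commute)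
  have "?r \<le> ?d + ?\<delta>" using norm_triangle_ineq4[of "\<zeta> - \<tau>" "z n - \<tau>"] by simp
  then show "?\<delta> / (?d + ?\<delta>) \<le> boundary_ratio \<tau> (z n) \<zeta>" unfolding boundary_ratio_def using r
    by (intro divide_left_mono mult_pos_pos add_pos_nonneg) (use d in auto)
qed

lemma integrable_ratio: "integrable \<sigma> (\<lambda>\<zeta>. (boundary_ratio \<tau> (z n) \<zeta>)\<^sup>2)"
proof (rule finite_measure.integrable_const_bound[OF fin, of _ "M\<^sup>2"])
  show "AE \<zeta> in \<sigma>. norm ((boundary_ratio \<tau> (z n) \<zeta>)\<^sup>2) \<le> M\<^sup>2"
    by (intro AE_I2) (use ratio_bounds M in \<open>auto intro: power_mono\<close>)
  show "(\<lambda>\<zeta>. (boundary_ratio \<tau> (z n) \<zeta>)\<^sup>2) \<in> borel_measurable \<sigma>"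
    unfolding boundary_ratio_def by (rule circle_measurable[OF sets]) measurable
qed

lemma log_measurable: "(\<lambda>\<zeta>. ln (1 / cmod (\<zeta> - \<tau>))) \<in> borel_measurable \<sigma>"
  by (rule circle_measurable[OF sets]) measurable

text \<open>
  With \<open>d = |\<zeta> - \<tau>|\<close> and \<open>|z\<^sub>n - \<tau>| \<le> K * \<alpha>^n\<close>, the ratio is at most a multiple of
  \<open>y\<^sub>n / (1 + y\<^sub>n)\<close> for \<open>y\<^sub>n = (K / d) * \<alpha>^n\<close>. The telescoping bound turns the partial
  sums of its square into at most a multiple of \<open>ln (1 + K / d)\<close>, uniformly in the number of terms.
\<close>

lemma log_integral_imp_summable:
  assumes K: "0 < K" "\<And>n. cmod (z n - \<tau>) \<le> K * \<alpha> ^ n" and log: "finite_log_integral \<sigma> \<tau>"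
  shows "summable (\<lambda>n. LINT \<zeta>|\<sigma>. (boundary_ratio \<tau> (z n) \<zeta>)\<^sup>2)"
proof -
  define A where "A = (1 + 2 * M)\<^sup>2 / (1 - \<alpha>)"
  have A: "0 \<le> A" using \<alpha> by (simp add: A_def)
  have int: "integrable \<sigma> (\<lambda>\<zeta>. A * (ln (2 + K) + ln (1 / cmod (\<zeta> - \<tau>))))"
    using log unfolding finite_log_integral_def
    by (intro integrable_mult_right Bochner_Integration.integrable_add finite_measure.integrable_const[OF fin])
  have bound: "(\<Sum>n<N. (boundary_ratio \<tau> (z n) \<zeta>)\<^sup>2) \<le> A * (ln (2 + K) + ln (1 / cmod (\<zeta> - \<tau>)))"
    if \<zeta>: "\<zeta> \<in> space \<sigma>" for \<zeta> N
  proof -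
    define d where "d = cmod (\<zeta> - \<tau>)"
    define y where "y n = K / d * \<alpha> ^ n" for n
    have d: "0 < d" "d \<le> 2"
      using ratio_bounds(1)[OF \<zeta>] \<zeta> norm_triangle_ineq4[of \<zeta> \<tau>] \<tau> by (auto simp: d_def space_circle)
    have y: "0 \<le> y n" "y (Suc n) = \<alpha> * y n" for n using K d \<alpha> by (auto simp: y_def)
    have summand: "(boundary_ratio \<tau> (z n) \<zeta>)\<^sup>2 \<le> A * (ln (1 + y n) - ln (1 + y (Suc n)))" for n
    proof -
      let ?\<delta> = "cmod (z n - \<tau>)"
      have "?\<delta> / (d + ?\<delta>) \<le> y n / (1 + y n)"
      proof -
        have "?\<delta> \<le> d * y n" using K(2)[of n] d by (simp add: y_def)
        then show ?thesis using d y(1)[of n] by (simp add: divide_simps add_pos_nonneg) (simp add: algebra_simps)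
      qed
      then have "(1 + 2 * M) * (?\<delta> / (d + ?\<delta>)) \<le> (1 + 2 * M) * (y n / (1 + y n))"
        using M by (intro mult_left_mono) auto
      then have "boundary_ratio \<tau> (z n) \<zeta> \<le> (1 + 2 * M) * (y n / (1 + y n))"
        using ratio_bounds(4)[OF \<zeta>, of n] by (simp add: d_def)
      then have "(boundary_ratio \<tau> (z n) \<zeta>)\<^sup>2 \<le> ((1 + 2 * M) * (y n / (1 + y n)))\<^sup>2"
        using ratio_bounds(2)[OF \<zeta>, of n] by (intro power_mono) auto
      also have "\<dots> = (1 + 2 * M)\<^sup>2 * (y n / (1 + y n))\<^sup>2" by (simp only: power_mult_distrib)
      also have "\<dots> \<le> (1 + 2 * M)\<^sup>2 * (y n / (1 + y n))"
      proof (rule mult_left_mono)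
        have "0 \<le> y n / (1 + y n)" "y n / (1 + y n) \<le> 1" using y(1)[of n] by auto
        then show "(y n / (1 + y n))\<^sup>2 \<le> y n / (1 + y n)"
          unfolding power2_eq_square by (intro mult_left_le)
      qed simp
      also have "\<dots> = A * ((1 - \<alpha>) * (y n / (1 + y n)))" using \<alpha> by (simp add: A_def)
      also have "\<dots> \<le> A * (ln (1 + y n) - ln (1 + y (Suc n)))"
        unfolding y(2) using A ln_diff_ge_ratio[OF y(1)[of n] \<alpha>] by (intro mult_left_mono) auto
      finally show ?thesis .
    qed
    have "(\<Sum>n<N. (boundary_ratio \<tau> (z n) \<zeta>)\<^sup>2) \<le> A * (\<Sum>n<N. ln (1 + y n) - ln (1 + y (Suc n)))"
      unfolding sum_distrib_left by (intro sum_mono summand)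
    also have "(\<Sum>n<N. ln (1 + y n) - ln (1 + y (Suc n))) = ln (1 + y 0) - ln (1 + y N)"
      by (rule sum_lessThan_telescope')
    also have "\<dots> \<le> ln (1 + y 0)" using y(1)[of N] by (simp add: ln_ge_zero)
    also have "\<dots> \<le> ln ((2 + K) * (1 / d))" using K d by (intro ln_mono) (auto simp: y_def field_simps add_pos_nonneg)
    also have "\<dots> = ln (2 + K) + ln (1 / d)" using K d by (intro ln_mult_pos) auto
    finally show ?thesis using A by (simp add: d_def mult_left_mono)
  qed
  show ?thesis
  proof (rule summableI_nonneg_bounded)
    fix N
    have "(\<Sum>n<N. (LINT \<zeta>|\<sigma>. (boundary_ratio \<tau> (z n) \<zeta>)\<^sup>2)) = (LINT \<zeta>|\<sigma>. (\<Sum>n<N. (boundary_ratio \<tau> (z n) \<zeta>)\<^sup>2))"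
      by (rule Bochner_Integration.integral_sum[symmetric]) (rule integrable_ratio)
    also have "\<dots> \<le> (LINT \<zeta>|\<sigma>. A * (ln (2 + K) + ln (1 / cmod (\<zeta> - \<tau>))))"
      by (intro integral_mono int bound Bochner_Integration.integrable_sum integrable_ratio)
    finally show "(\<Sum>n<N. (LINT \<zeta>|\<sigma>. (boundary_ratio \<tau> (z n) \<zeta>)\<^sup>2)) \<le> (LINT \<zeta>|\<sigma>. A * (ln (2 + K) + ln (1 / cmod (\<zeta> - \<tau>))))" .
  qed simp
qed

text \<open>
  With \<open>|z\<^sub>n - \<tau>| \<ge> c * \<alpha>^n\<close> and \<open>y\<^sub>n = (c / d) * \<alpha>^n\<close>, a multiple of the squared
  ratio dominates the differences of the decreasing sequence \<open>ln (1 + y\<^sub>n^2)\<close>, whose sum is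
  \<open>ln (1 + (c / d)^2)\<close>. Integrating the series term by term shows that this function is integrable,
  and it is \<open>2 * ln (1 / d)\<close> up to an additive constant as \<open>d\<close> tends to \<open>0\<close>.
\<close>

lemma summable_imp_log_integral:
  assumes c: "0 < c" "\<And>n. c * \<alpha> ^ n \<le> cmod (z n - \<tau>)"
    and sum: "summable (\<lambda>n. LINT \<zeta>|\<sigma>. (boundary_ratio \<tau> (z n) \<zeta>)\<^sup>2)"
  shows "finite_log_integral \<sigma> \<tau>"
proof -
  define y where "y n \<zeta> = c / cmod (\<zeta> - \<tau>) * \<alpha> ^ n" for n \<zeta>
  define f where "f n \<zeta> = ln (1 + (y n \<zeta>)\<^sup>2) - ln (1 + (y (Suc n) \<zeta>)\<^sup>2)" for n \<zeta>
  have y: "0 \<le> y n \<zeta>" "y (Suc n) \<zeta> = \<alpha> * y n \<zeta>" for n \<zeta> using c \<alpha> by (auto simp: y_def)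
  have f_nonneg: "0 \<le> f n \<zeta>" for n \<zeta>
  proof -
    have "(y (Suc n) \<zeta>)\<^sup>2 \<le> (y n \<zeta>)\<^sup>2"
      unfolding y(2) using y(1)[of n \<zeta>] \<alpha> by (intro power_mono mult_left_le_one_le) auto
    then show ?thesis unfolding f_def by (simp add: add_pos_nonneg)
  qed
  have f_le: "f n \<zeta> \<le> 2 / \<alpha>\<^sup>2 * (boundary_ratio \<tau> (z n) \<zeta>)\<^sup>2" if \<zeta>: "\<zeta> \<in> space \<sigma>" for n \<zeta>
  proof -
    define d where "d = cmod (\<zeta> - \<tau>)"
    let ?\<delta> = "cmod (z n - \<tau>)"
    have d: "0 < d" using ratio_bounds(1)[OF \<zeta>] by (simp add: d_def)
    have "y n \<zeta> / (1 + y n \<zeta>) \<le> ?\<delta> / (d + ?\<delta>)"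
    proof -
      have "d * y n \<zeta> \<le> ?\<delta>" using c(2)[of n] d by (simp add: y_def d_def)
      then show ?thesis using d y(1)[of n \<zeta>] by (simp add: divide_simps add_pos_nonneg) (simp add: algebra_simps)
    qed
    also have "\<dots> \<le> boundary_ratio \<tau> (z n) \<zeta>" using ratio_bounds(5)[OF \<zeta>] by (simp add: d_def)
    finally have "(y n \<zeta> / (1 + y n \<zeta>))\<^sup>2 \<le> (boundary_ratio \<tau> (z n) \<zeta>)\<^sup>2" using y(1) by (intro power_mono) auto
    then have "2 / \<alpha>\<^sup>2 * (y n \<zeta> / (1 + y n \<zeta>))\<^sup>2 \<le> 2 / \<alpha>\<^sup>2 * (boundary_ratio \<tau> (z n) \<zeta>)\<^sup>2" by (intro mult_left_mono) auto
    then show ?thesis unfolding f_def y(2) using ln_diff_le_ratio_squared[OF y(1) \<alpha>, of n \<zeta>] by linarith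
  qed
  have f_meas: "f n \<in> borel_measurable \<sigma>" for n
    unfolding f_def y_def by (rule circle_measurable[OF sets]) measurable
  have f_int: "integrable \<sigma> (f n)" for n
    by (rule Bochner_Integration.integrable_bound[OF integrable_mult_right[OF integrable_ratio, of "2 / \<alpha>\<^sup>2" n] f_meas])
      (intro AE_I2, use f_le f_nonneg in auto)
  have f_sums: "(\<lambda>n. f n \<zeta>) sums ln (1 + (y 0 \<zeta>)\<^sup>2)" for \<zeta>
  proof -
    have "(\<lambda>n. y n \<zeta>) \<longlonglongrightarrow> c / cmod (\<zeta> - \<tau>) * 0"
      unfolding y_def using \<alpha> by (intro tendsto_mult tendsto_const LIMSEQ_realpow_zero) auto
    then have "(\<lambda>n. ln (1 + (y n \<zeta>)\<^sup>2)) \<longlonglongrightarrow> ln (1 + (c / cmod (\<zeta> - \<tau>) * 0)\<^sup>2)"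
      by (intro tendsto_intros) auto
    from telescope_sums'[OF this] show ?thesis by (simp add: f_def)
  qed
  have "integrable \<sigma> (\<lambda>\<zeta>. \<Sum>n. f n \<zeta>)"
  proof (rule integrable_suminf[OF f_int])
    show "AE \<zeta> in \<sigma>. summable (\<lambda>n. norm (f n \<zeta>))"
      using f_sums f_nonneg by (intro AE_I2) (auto simp: sums_iff)
    show "summable (\<lambda>n. LINT \<zeta>|\<sigma>. norm (f n \<zeta>))"
    proof (rule summable_comparison_test'[of _ 0])
      show "summable (\<lambda>n. 2 / \<alpha>\<^sup>2 * (LINT \<zeta>|\<sigma>. (boundary_ratio \<tau> (z n) \<zeta>)\<^sup>2))" using sum by (rule summable_mult)
      fix n
      have "(LINT \<zeta>|\<sigma>. norm (f n \<zeta>)) \<le> (LINT \<zeta>|\<sigma>. 2 / \<alpha>\<^sup>2 * (boundary_ratio \<tau> (z n) \<zeta>)\<^sup>2)"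
        by (intro integral_mono integrable_norm f_int integrable_mult_right integrable_ratio)
          (use f_le f_nonneg in auto)
      then show "norm (LINT \<zeta>|\<sigma>. norm (f n \<zeta>)) \<le> 2 / \<alpha>\<^sup>2 * (LINT \<zeta>|\<sigma>. (boundary_ratio \<tau> (z n) \<zeta>)\<^sup>2)"
        by simp
    qed
  qed
  then have int: "integrable \<sigma> (\<lambda>\<zeta>. ln (1 + (y 0 \<zeta>)\<^sup>2))"
    using f_sums by (simp add: sums_iff)
  have "integrable \<sigma> (\<lambda>\<zeta>. ln (1 + (y 0 \<zeta>)\<^sup>2) + (\<bar>ln c\<bar> + ln 2))"
    using int finite_measure.integrable_const[OF fin] by (intro Bochner_Integration.integrable_add) auto
  then show ?thesis unfolding finite_log_integral_def
  proof (rule Bochner_Integration.integrable_bound[OF _ log_measurable], intro AE_I2)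
    fix \<zeta> assume \<zeta>: "\<zeta> \<in> space \<sigma>"
    define d where "d = cmod (\<zeta> - \<tau>)"
    have d: "0 < d" "d \<le> 2"
      using ratio_bounds(1)[OF \<zeta>] \<zeta> norm_triangle_ineq4[of \<zeta> \<tau>] \<tau> by (auto simp: d_def space_circle)
    have "ln d \<le> ln 2" using d by (intro ln_mono) auto
    then have lower: "- ln 2 \<le> ln (1 / d)" using d by (simp add: ln_div)
    have "0 < ln (2::real)" by simp
    have pos: "0 \<le> ln (1 + (c / d)\<^sup>2)" by (simp add: ln_ge_zero)
    have "2 * ln (c / d) = ln ((c / d)\<^sup>2)" using c d by (simp add: ln_realpow)
    also have "\<dots> \<le> ln (1 + (c / d)\<^sup>2)" using c d by (intro ln_mono) auto
    finally have "2 * (ln c + ln (1 / d)) \<le> ln (1 + (c / d)\<^sup>2)" using c d by (simp add: ln_div)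
    \<comment> \<open>To be used with \<open>u = ln c\<close>, \<open>v = ln (1 / d)\<close> and \<open>k = ln 2\<close>.\<close>
    moreover have "\<bar>v\<bar> \<le> w + (\<bar>u\<bar> + k)" if "2 * (u + v) \<le> w" "- k \<le> v" "0 \<le> w" "0 < k"
      for u v w k :: real
      using that abs_ge_minus_self[of u] abs_ge_zero[of u] by (intro abs_leI) auto
    ultimately have "\<bar>ln (1 / d)\<bar> \<le> ln (1 + (c / d)\<^sup>2) + (\<bar>ln c\<bar> + ln 2)"
      using lower pos \<open>0 < ln (2::real)\<close> by blast
    then show "norm (ln (1 / cmod (\<zeta> - \<tau>))) \<le> norm (ln (1 + (y 0 \<zeta>)\<^sup>2) + (\<bar>ln c\<bar> + ln 2))"
      using pos by (simp add: y_def d_def)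
  qed
qed

end

lemma Re_Cayley_disc:
  "cmod \<tau> = 1 \<Longrightarrow>
    Re ((1 + cnj \<tau> * z) / (1 - cnj \<tau> * z)) = (1 - (cmod z)\<^sup>2) / (cmod (z - \<tau>))\<^sup>2"
  using norm_one_minus_cnj_mult[of \<tau> z] by (simp add: Re_Cayley norm_mult)

text \<open>
  The real part of the Herglotz formula. On the left and in the first term on the right it is the
  Poisson kernel with pole \<open>\<tau>\<close>; under the integral it is the kernel with pole \<open>\<zeta>\<close>, from which the
  kernel with pole \<open>\<tau>\<close> is factored out.
\<close>

lemma herglotz_recursion:
  assumes h: "herglotz_measure G \<tau> \<alpha> \<sigma>" and \<tau>: "cmod \<tau> = 1" and z: "z \<in> \<D>" and \<alpha>: "0 < \<alpha>"
  shows "(1 - (cmod (G z))\<^sup>2) / (cmod (G z - \<tau>))\<^sup>2 =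
     (1 - (cmod z)\<^sup>2) / (cmod (z - \<tau>))\<^sup>2 / \<alpha> *
       (1 + \<alpha> * (LINT \<zeta>|\<sigma>. (boundary_ratio \<tau> z \<zeta>)\<^sup>2))"
proof -
  have sets: "sets \<sigma> = sets (restrict_space borel (sphere 0 1 - {\<tau>}))" and fin: "finite_measure \<sigma>"
    using h by (auto simp: herglotz_measure_def)
  have sp: "cmod \<zeta> = 1" if "\<zeta> \<in> space \<sigma>" for \<zeta>
    using that sets_eq_imp_space_eq[OF sets] by (auto simp: space_restrict_space)
  obtain b where b: "(1 + cnj \<tau> * G z) / (1 - cnj \<tau> * G z) =
        of_real (1 / \<alpha>) * ((1 + cnj \<tau> * z) / (1 - cnj \<tau> * z)) + \<i> * of_real b +
        (LINT \<zeta>|\<sigma>. (\<zeta> + z) / (\<zeta> - z))"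
    using h z by (auto simp: herglotz_measure_def)
  have z1: "cmod z < 1" using z by simp
  have lower: "1 - cmod z \<le> cmod (\<zeta> - z)" if "\<zeta> \<in> space \<sigma>" for \<zeta>
    using norm_triangle_ineq2[of \<zeta> z] sp[OF that] by simp
  have int: "integrable \<sigma> (\<lambda>\<zeta>. (\<zeta> + z) / (\<zeta> - z))"
  proof (rule finite_measure.integrable_const_bound[OF fin])
    show "AE \<zeta> in \<sigma>. norm ((\<zeta> + z) / (\<zeta> - z)) \<le> 2 / (1 - cmod z)"
    proof (intro AE_I2)
      fix \<zeta> assume \<zeta>: "\<zeta> \<in> space \<sigma>"
      show "norm ((\<zeta> + z) / (\<zeta> - z)) \<le> 2 / (1 - cmod z)"
        unfolding norm_divide using lower[OF \<zeta>] sp[OF \<zeta>] z1 norm_triangle_ineq[of \<zeta> z]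
        by (intro frac_le) auto
    qed
    show "(\<lambda>\<zeta>. (\<zeta> + z) / (\<zeta> - z)) \<in> borel_measurable \<sigma>"
      by (rule circle_measurable[OF sets]) measurable
  qed
  have zt: "cmod (z - \<tau>) \<noteq> 0" using z1 \<tau> by auto
  have "Re (LINT \<zeta>|\<sigma>. (\<zeta> + z) / (\<zeta> - z)) = (LINT \<zeta>|\<sigma>. Re ((\<zeta> + z) / (\<zeta> - z)))"
    using int by simp
  also have "\<dots> = (LINT \<zeta>|\<sigma>. (1 - (cmod z)\<^sup>2) / (cmod (z - \<tau>))\<^sup>2 * (boundary_ratio \<tau> z \<zeta>)\<^sup>2)"
    using zt by (intro Bochner_Integration.integral_cong refl) (simp add: boundary_ratio_def Re_Cayley sp power_divide)
  also have "\<dots> = (1 - (cmod z)\<^sup>2) / (cmod (z - \<tau>))\<^sup>2 * (LINT \<zeta>|\<sigma>. (boundary_ratio \<tau> z \<zeta>)\<^sup>2)"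
    by simp
  finally have I: "Re (LINT \<zeta>|\<sigma>. (\<zeta> + z) / (\<zeta> - z)) = \<dots>" .
  have R: "Re (of_real (1 / \<alpha>) * w) = Re w / \<alpha>" for w
    by (simp add: Re_divide_of_real)
  show ?thesis
    using arg_cong[OF b, of Re] I \<alpha> unfolding plus_complex.simps R Re_Cayley_disc[OF \<tau>]
    by (simp add: distrib_left)
qed

text \<open>
  In a Stolz region \<open>t n\<close>, \<open>\<delta> n\<close> and \<open>1 / x n\<close> are comparable, so \<open>disc_dist\<close> to the origin is
  \<open>ln (x n)\<close> up to a bounded error, and two-sided bounds on \<open>x n * \<alpha> ^ n\<close> become two-sided
  bounds of \<open>\<delta> n\<close> by multiples of \<open>\<alpha> ^ n\<close>. The lower bound on \<open>x n * \<alpha> ^ n\<close> always holds; the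
  upper bound follows from summability of \<open>a\<close>. These are exactly what the two directions need.
\<close>

lemma extremal_orbit_iff_log_integral:
  assumes h: "herglotz_measure G \<tau> \<alpha> \<sigma>" and \<tau>: "cmod \<tau> = 1" and \<alpha>: "0 < \<alpha>" "\<alpha> < 1"
    and M: "1 < M" and z: "\<And>n. (G ^^ n) z0 \<in> stolz_region \<tau> M"
  shows "(\<lambda>n. disc_dist ((G ^^ n) z0) 0 - real n * ln (1 / \<alpha>)) \<in> O(\<lambda>_. 1) \<longleftrightarrow> finite_log_integral \<sigma> \<tau>"
proof -
  have sets: "sets \<sigma> = sets (restrict_space borel (sphere 0 1 - {\<tau>}))" and fin: "finite_measure \<sigma>"
    using h by (auto simp: herglotz_measure_def)
  define s where "s n = (G ^^ n) z0" for n
  have s: "s n \<in> stolz_region \<tau> M" for n using z by (simp add: s_def)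
  note ctx = sets fin \<tau> \<alpha> M s
  define \<delta> where "\<delta> n = cmod (s n - \<tau>)" for n
  define t where "t n = 1 - (cmod (s n))\<^sup>2" for n
  define x where "x n = t n / (\<delta> n)\<^sup>2" for n
  define a where "a n = (LINT \<zeta>|\<sigma>. (boundary_ratio \<tau> (s n) \<zeta>)\<^sup>2)" for n
  have sD: "s n \<in> \<D>" for n using s by (simp add: stolz_region_def)
  have st: "0 < \<delta> n" "\<delta> n < M * (1 - cmod (s n))" "1 - cmod (s n) \<le> \<delta> n" for n
    using stolz(2-4)[where z = s, OF ctx, of n] by (auto simp: \<delta>_def)
  have t: "0 < t n" "t n \<le> 2 * \<delta> n" "\<delta> n \<le> M * t n" for n
  proof -
    have c: "0 \<le> cmod (s n)" "cmod (s n) < 1" using sD by auto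
    have e: "t n = (1 - cmod (s n)) * (1 + cmod (s n))" by (simp add: t_def power2_eq_square algebra_simps)
    show "0 < t n" using sD one_minus_norm_sq_pos by (simp add: t_def)
    have "t n \<le> (1 - cmod (s n)) * 2" unfolding e using c by (intro mult_left_mono) auto
    then show "t n \<le> 2 * \<delta> n" using st(3)[of n] by simp
    have "1 - cmod (s n) \<le> t n" unfolding e using c by (simp add: mult_le_cancel_left1)
    then have "M * (1 - cmod (s n)) \<le> M * t n" using M by (intro mult_left_mono) auto
    then show "\<delta> n \<le> M * t n" using st(2)[of n] by simp
  qed
  have x0: "0 < x n" for n using t(1)[of n] st(1)[of n] by (simp add: x_def)
  have x_le: "x n \<le> 2 / \<delta> n" for n
    using t(2)[of n] st(1)[of n] by (simp add: x_def field_simps power2_eq_square)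
  have x_ge: "1 / (M * \<delta> n) \<le> x n" for n
    using t(3)[of n] st(1)[of n] M by (simp add: x_def field_simps power2_eq_square)
  have rec: "x (Suc n) = x n / \<alpha> * (1 + \<alpha> * a n)" for n
    using herglotz_recursion[OF h \<tau> sD \<alpha>(1), of n]
    by (simp add: x_def t_def \<delta>_def a_def boundary_ratio_def s_def)
  have a0: "0 \<le> a n" for n by (simp add: a_def)
  note growth = growth_bounded_iff_summable[where x = x and a = a, OF \<alpha> x0 a0 rec]
  have ln_t: "\<bar>disc_dist (s n) 0 - ln (x n)\<bar> \<le> ln 4 + 2 * ln M" for n
  proof -
    have q: "- ln (t n) \<le> disc_dist (s n) 0" "disc_dist (s n) 0 \<le> ln 4 - ln (t n)"
      using disc_dist_log_bounds[OF sD[of n], of 0] by (auto simp: t_def Moebius_function_simple)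
    have "ln (x n) = ln (t n) - 2 * ln (\<delta> n)"
      using t(1)[of n] st(1)[of n] by (simp add: x_def ln_div ln_realpow)
    moreover have "ln (t n) \<le> ln (2 * \<delta> n)" "ln (\<delta> n) \<le> ln (M * t n)"
      using t[of n] st(1)[of n] by (auto intro!: ln_mono)
    then have "ln (t n) \<le> ln 2 + ln (\<delta> n)" "ln (\<delta> n) \<le> ln M + ln (t n)"
      using t(1)[of n] st(1)[of n] M by (auto simp: ln_mult_pos)
    moreover have "ln 4 = 2 * ln (2::real)" using ln_realpow[of 2 2] by simp
    moreover have "0 \<le> ln M" using M by simp
    ultimately show ?thesis using q by linarith
  qed
  have "(\<lambda>n. disc_dist (s n) 0 - real n * ln (1 / \<alpha>)) \<in> O(\<lambda>_. 1) \<longleftrightarrow>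
      (\<lambda>n. ln (x n) - real n * ln (1 / \<alpha>)) \<in> O(\<lambda>_. 1)"
    by (rule bigo_1_cong_bounded_difference[of _ _ "ln 4 + 2 * ln M"]) (use ln_t in auto)
  also have "\<dots> \<longleftrightarrow> summable a" by (rule growth(2))
  also have "\<dots> \<longleftrightarrow> finite_log_integral \<sigma> \<tau>"
  proof
    assume "finite_log_integral \<sigma> \<tau>"
    then show "summable a" unfolding a_def
    proof (rule log_integral_imp_summable[where z = s, OF ctx, rotated 2])
      show "0 < 2 / x 0" using x0 by simp
      fix n
      have "x 0 \<le> 2 / \<delta> n * \<alpha> ^ n"
        using growth(1)[of n] mult_right_mono[OF x_le[of n], of "\<alpha> ^ n"] \<alpha> by simp
      then show "cmod (s n - \<tau>) \<le> 2 / x 0 * \<alpha> ^ n"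
        using st(1)[of n] x0[of 0] by (simp add: \<delta>_def[symmetric] field_simps)
    qed
  next
    assume sum: "summable a"
    from growth(3)[OF this] obtain C where C: "0 < C" "\<And>n. x n * \<alpha> ^ n \<le> C" by blast
    show "finite_log_integral \<sigma> \<tau>"
    proof (rule summable_imp_log_integral[where z = s, OF ctx _ _ sum[unfolded a_def]])
      show "0 < 1 / (M * C)" using M C by simp
      fix n
      have "1 / (M * \<delta> n) * \<alpha> ^ n \<le> C"
        using C(2)[of n] mult_right_mono[OF x_ge[of n], of "\<alpha> ^ n"] \<alpha> by simp
      then show "1 / (M * C) * \<alpha> ^ n \<le> cmod (s n - \<tau>)"
        using st(1)[of n] C(1) M by (simp add: \<delta>_def[symmetric] field_simps)
    qed
  qed
  finally show ?thesis by (simp add: s_def)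
qed

theorem theorem3p24:
  fixes \<Omega> :: "complex set" and p g G :: "complex \<Rightarrow> complex"
    and \<tau> :: complex and \<alpha> :: real
  assumes "\<Omega> \<subset> UNIV" and "hyperbolic_domain \<Omega>"
    and "universal_covering_map p \<Omega>"
    and "g holomorphic_on \<Omega>" and "g ` \<Omega> \<subseteq> \<Omega>" and "\<forall>w\<in>\<Omega>. g w \<noteq> w"
    and "G holomorphic_on \<D>" and "G ` \<D> \<subseteq> \<D>" and "\<forall>z\<in>\<D>. p (G z) = g (p z)"
    and "hyperbolic_self_map G \<tau> \<alpha>"
    and "\<tau> \<notin> limit_set (deck_group p)"
    and "\<exists>z\<in>\<D>. nontangential_seq (\<lambda>n. (G ^^ n) z) \<tau>"
  shows "(extremal_hyperbolic_rate \<Omega> g \<alpha> \<longleftrightarrow> extremal_hyperbolic_rate \<D> G \<alpha>) \<and>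
         (\<forall>\<sigma>. herglotz_measure G \<tau> \<alpha> \<sigma> \<longrightarrow>
            (extremal_hyperbolic_rate \<Omega> g \<alpha> \<longleftrightarrow> finite_log_integral \<sigma> \<tau>))"
proof -
  have \<tau>: "cmod \<tau> = 1" and \<alpha>: "0 < \<alpha>" "\<alpha> < 1"
    using assms(10) by (auto simp: hyperbolic_self_map_def denjoy_wolff_point_def)
  obtain z M N where z: "z \<in> \<D>" and M: "1 < M" and lim: "(\<lambda>n. (G ^^ n) z) \<longlonglongrightarrow> \<tau>"
    and N: "\<And>n. n \<ge> N \<Longrightarrow> (G ^^ n) z \<in> stolz_region \<tau> M"
    using assms(12) unfolding nontangential_seq_def eventually_sequentially by blast
  \<comment> \<open>Start the orbit late enough for all of it to lie in the Stolz region.\<close>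
  define z0 where "z0 = (G ^^ N) z"
  have z0: "z0 \<in> \<D>" using funpow_in_disc[OF assms(8) z] by (simp add: z0_def)
  have it: "(G ^^ n) z0 = (G ^^ (n + N)) z" for n by (simp add: z0_def funpow_add)
  have lim0: "(\<lambda>n. (G ^^ n) z0) \<longlonglongrightarrow> \<tau>"
    unfolding it using lim by (rule LIMSEQ_ignore_initial_segment)
  have stolz0: "(G ^^ n) z0 \<in> stolz_region \<tau> M" for n unfolding it by (rule N) simp
  show ?thesis
    using extremal_rate_covering_iff[OF assms(3,7-9) z0 \<tau> lim0 assms(11), of \<alpha>]
      extremal_rate_disc_iff[OF assms(7,8) z0, of \<alpha>]
      extremal_orbit_iff_log_integral[OF _ \<tau> \<alpha> M stolz0] by blast
qed

end
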